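(* Let the graph $\Gamma$ of the simply-laced Kac–Moody algebra $\mathfrak{g}$ be a tree with a fixed root $r\in I$. Let $\beta$ (respectively $\beta'$) be bubble parameters with compatible choice of scalars $Q=\{t_{ij}\}$ (respectively $Q'=\{t'_{ij}\}$), with bubble coefficients $\mathsf{c}^{\pm}_{i,\lambda}$ (respectively $\mathsf{c}'^{\pm}_{i,\lambda}$). Let $D_i\in\Bbbk^\times$, the relation $<$ on $I$ (comparison of levels), and the algebra isomorphism $\gimel\colon R_Q\to R_{Q'}$ of KLR algebras be as in the context. Then $\gimel$ extends to an isomorphism of 2-categories $$\gimel\colon\mathcal{U}_{Q,\beta}(\mathfrak{g})\longrightarrow\mathcal{U}_{Q',\beta'}(\mathfrak{g})$$ (identity on objects and 1-morphisms) given on generating 2-morphisms by $\gimel(x_{i,\lambda})=D_i\,x_{i,\lambda}$, $\gimel(\psi_{ij,\lambda})=\gamma_{ij}\,\psi_{ij,\lambda}$, where $$\gamma_{ij}=\begin{cases}D_i^{-1}&\text{if }i=j,\\ t_{ji}(t'_{ji})^{-1}D_j&\text{if }i<j\text{ and }i\cdot j=-1,\\ t_{ij}(t'_{ij})^{-1}&\text{if }i<j\text{ and }i\cdot j=0,\\ 1&\text{otherwise,}\end{cases}$$ and $$\gimel(\epsilon_{i,\lambda})=D_i^{-\lambda_i+1}\,\frac{\mathsf{c}^{+}_{i,\lambda}}{\mathsf{c}'^{+}_{i,\lambda}}\;\epsilon_{i,\lambda},\qquad \gimel(\eta_{i,\lambda})=D_i^{\lambda_i+1}\,\frac{\mathsf{c}'^{+}_{i,\lambda+\alpha_i}}{\mathsf{c}^{+}_{i,\lambda+\alpha_i}}\;\eta_{i,\lambda},$$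 while the other cap and cup are sent to themselves: $\gimel(\epsilon'_{i,\lambda})=\epsilon'_{i,\lambda}$, $\gimel(\eta'_{i,\lambda})=\eta'_{i,\lambda}$.
   Context: **Cartan data.** $\Bbbk$ is a field. A symmetric (simply-laced) Cartan datum consists of a free $\mathbb{Z}$-module $X$ (weight lattice), an index set $I$, elements $\alpha_i,\Lambda_i\in X$ and $h_i\in X^\vee=\mathrm{Hom}_{\mathbb{Z}}(X,\mathbb{Z})$ for $i\in I$, and a bilinear form $(\cdot,\cdot)$ on $X$ with $(\alpha_i,\alpha_i)=2$; $(\alpha_i,\alpha_j)\in\{0,-1\}$ for $i\neq j$; $\langle h_i,\lambda\rangle=(\alpha_i,\lambda)$; $\langle h_j,\Lambda_i\rangle=\delta_{ij}$. The matrix $a_{ij}=\langle h_i,\alpha_j\rangle=(\alpha_i,\alpha_j)$ is the Cartan matrix of $\mathfrak{g}$. Write $i\cdot j=(\alpha_i,\alpha_j)$ and $\lambda_i=\langle h_i,\lambda\rangle$. The graph $\Gamma$ has vertex set $I$ and an edge between $i\neq j$ iff $i\cdot j=-1$. **Parameters.** A choice of scalars $Q$ is a family $t_{ij}\in\Bbbk^\times$ ($i\neq j$) with $t_{ij}=t_{ji}$ when $a_{ij}=0$. Bubble parameters $\beta$ consist of scalars $\beta_i=\beta_{i,\lambda}\in\Bbbk^\times$ (one scalar $\beta_i$ for each $i$, also written $\beta_{i,\lambda}$) and $\mathsf{c}^{+}_{i,\lambda},\mathsf{c}^{-}_{i,\lambda}\in\Bbbk^\times$ for $i\in I,\lambda\in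 X$. Put $t_{ii}:=-\beta_i$. They are compatible with $Q$ if for all $i,j\in I$ (including $i=j$) and $\lambda\in X$: $\mathsf{c}^{+}_{i,\lambda}\mathsf{c}^{-}_{i,\lambda}=-1/\beta_i=1/t_{ii}$, $\ \mathsf{c}^{+}_{i,\lambda+\alpha_j}=t_{ij}\mathsf{c}^{+}_{i,\lambda}$, $\ \mathsf{c}^{-}_{i,\lambda-\alpha_j}=t_{ij}\mathsf{c}^{-}_{i,\lambda}$. Likewise for primed parameters. **Tree data.** Suppose $\Gamma$ is a tree with root $r\in I$; orient all edges away from $r$. For an edge $e$ let $s(e)$ be its source and $t(e)$ its target. The level of a vertex is its distance from $r$. Write $i<j$ if vertex $i$ occurs in a lower level than vertex $j$ (so distinct vertices of equal level are not related by $<$). Let $P_i$ be the unique directed path of edges from $r$ to $i$. Put $v_{ij}=t_{ij}^{-1}t_{ji}$, $v'_{ij}=(t'_{ij})^{-1}t'_{ji}$ and $D_i:=\prod_{e\in P_i}v'_{s(e)t(e)}\,v_{t(e)s(e)}$, so $D_r=1$. **KLR algebras.** $R_Q$ is the algebra of $\Bbbk$-linear combinations of diagrams of upward $I$-labelled strands with dots and crossings, modulo the KLR relations in (3) below (forgetting weights), and the algebra isomorphism $\gimel\colon R_Q\to R_{Q'}$ multiplies an $i$-labelled dot by $D_i$ and a crossing with bottom labels $i$ (left), $j$ (right) by the scalar $\gamma_{ij}$ given in the claim. **The 2-category $\mathcal{U}_{Q,\beta}(\mathfrak{g})$** (for $\beta$ compatible with $Q$) is the graded additive $\Bbbk$-linear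 2-category with: - Objects: $\lambda\in X$. - 1-morphisms: formal direct sums of grading shifts $\langle t\rangle$ of composites of $\mathbf{1}_\lambda$, $\mathcal{E}_i\mathbf{1}_\lambda=\mathbf{1}_{\lambda+\alpha_i}\mathcal{E}_i$, $\mathcal{F}_i\mathbf{1}_\lambda=\mathbf{1}_{\lambda-\alpha_i}\mathcal{F}_i$. - 2-morphisms: $\Bbbk$-linear combinations of vertical/horizontal composites of the following generators (with identities and shifts): dots $x_{i,\lambda}\colon\mathcal{E}_i\mathbf{1}_\lambda\to\mathcal{E}_i\mathbf{1}_\lambda\langle 2\rangle$; crossings $\psi_{ij,\lambda}\colon\mathcal{E}_i\mathcal{E}_j\mathbf{1}_\lambda\to\mathcal{E}_j\mathcal{E}_i\mathbf{1}_\lambda\langle -i\cdot j\rangle$; cups $\eta_{i,\lambda}\colon\mathbf{1}_\lambda\to\mathcal{F}_i\mathcal{E}_i\mathbf{1}_\lambda\langle 1+\lambda_i\rangle$ and $\eta'_{i,\lambda}\colon\mathbf{1}_\lambda\to\mathcal{E}_i\mathcal{F}_i\mathbf{1}_\lambda\langle 1-\lambda_i\rangle$; caps $\epsilon'_{i,\lambda}\colon\mathcal{F}_i\mathcal{E}_i\mathbf{1}_\lambda\to\mathbf{1}_\lambda\langle 1+\lambda_i\rangle$ and $\epsilon_{i,\lambda}\colon\mathcal{E}_i\mathcal{F}_i\mathbf{1}_\lambda\to\mathbf{1}_\lambda\langle 1-\lambda_i\rangle$. Horizontal composition with identity 2-morphisms of $\mathcal{E}_i,\mathcal{F}_i$ is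 written by juxtaposition; weight subscripts and shifts are suppressed when determined by the source. The relations (for all indices and weights) are: (1) Biadjointness: $(\epsilon_{i,\lambda+\alpha_i}\mathcal{E}_i)(\mathcal{E}_i\eta_{i,\lambda})=\mathrm{id}_{\mathcal{E}_i\mathbf{1}_\lambda}=(\mathcal{E}_i\epsilon'_{i,\lambda})(\eta'_{i,\lambda+\alpha_i}\mathcal{E}_i)$ and $(\mathcal{F}_i\epsilon_{i,\lambda+\alpha_i})(\eta_{i,\lambda}\mathcal{F}_i)=\mathrm{id}_{\mathcal{F}_i\mathbf{1}_{\lambda+\alpha_i}}=(\epsilon'_{i,\lambda}\mathcal{F}_i)(\mathcal{F}_i\eta'_{i,\lambda+\alpha_i})$. (2) Cyclicity: on $\mathcal{F}_i\mathbf{1}_{\lambda+\alpha_i}$, $(\epsilon'_i\mathcal{F}_i)(\mathcal{F}_ix_i\mathcal{F}_i)(\mathcal{F}_i\eta'_i)=(\mathcal{F}_i\epsilon_i)(\mathcal{F}_ix_i\mathcal{F}_i)(\eta_i\mathcal{F}_i)$ (this is the downward dot). As maps $\mathcal{F}_i\mathcal{F}_j\mathbf{1}_\lambda\to\mathcal{F}_j\mathcal{F}_i\mathbf{1}_\lambda\langle -i\cdot j\rangle$, the two composites $\mathcal{F}_i\mathcal{F}_j\xrightarrow{\eta_j}\mathcal{F}_j\mathcal{E}_j\mathcal{F}_i\mathcal{F}_j\xrightarrow{\eta_i}\mathcal{F}_j\mathcal{F}_i\mathcal{E}_i\mathcal{E}_j\mathcal{F}_i\mathcal{F}_j\xrightarrow{\psi_{ij}}\mathcal{F}_j\mathcal{F}_i\mathcal{E}_j\mathcal{E}_i\mathcal{F}_i\mathcal{F}_j\xrightarrow{\epsilon_i}\mathcal{F}_j\mathcal{F}_i\mathcal{E}_j\mathcal{F}_j\xrightarrow{\epsilon_j}\mathcal{F}_j\mathcal{F}_i$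 and $\mathcal{F}_i\mathcal{F}_j\xrightarrow{\eta'_i}\mathcal{F}_i\mathcal{F}_j\mathcal{E}_i\mathcal{F}_i\xrightarrow{\eta'_j}\mathcal{F}_i\mathcal{F}_j\mathcal{E}_i\mathcal{E}_j\mathcal{F}_j\mathcal{F}_i\xrightarrow{\psi_{ij}}\mathcal{F}_i\mathcal{F}_j\mathcal{E}_j\mathcal{E}_i\mathcal{F}_j\mathcal{F}_i\xrightarrow{\epsilon'_j}\mathcal{F}_i\mathcal{E}_i\mathcal{F}_j\mathcal{F}_i\xrightarrow{\epsilon'_i}\mathcal{F}_j\mathcal{F}_i$ are equal (this is the downward crossing). Sideways crossings are defined by $\sigma_{ij}:=(\mathcal{F}_j\mathcal{E}_i\epsilon_j)(\mathcal{F}_j\psi_{ji}\mathcal{F}_j)(\eta_j\mathcal{E}_i\mathcal{F}_j)\colon\mathcal{E}_i\mathcal{F}_j\mathbf{1}_\lambda\to\mathcal{F}_j\mathcal{E}_i\mathbf{1}_\lambda$ and $\sigma'_{ij}:=(\epsilon'_i\mathcal{E}_j\mathcal{F}_i)(\mathcal{F}_i\psi_{ji}\mathcal{F}_i)(\mathcal{F}_i\mathcal{E}_j\eta'_i)\colon\mathcal{F}_i\mathcal{E}_j\mathbf{1}_\lambda\to\mathcal{E}_j\mathcal{F}_i\mathbf{1}_\lambda$. (3) KLR relations: $\psi_{ji}\psi_{ij}=0$ if $i=j$; $=t_{ij}\,\mathrm{id}$ if $i\cdot j=0$; $=t_{ij}\,x_i\mathcal{E}_j+t_{ji}\,\mathcal{E}_ix_j$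 if $i\cdot j=-1$. NilHecke: $\psi_{ii}(x_i\mathcal{E}_i)-(\mathcal{E}_ix_i)\psi_{ii}=\mathrm{id}=(x_i\mathcal{E}_i)\psi_{ii}-\psi_{ii}(\mathcal{E}_ix_i)$. For $i\neq j$: $\psi_{ij}(x_i\mathcal{E}_j)=(\mathcal{E}_jx_i)\psi_{ij}$ and $(x_j\mathcal{E}_i)\psi_{ij}=\psi_{ij}(\mathcal{E}_ix_j)$. Cubic: $(\psi_{jk}\mathcal{E}_i)(\mathcal{E}_j\psi_{ik})(\psi_{ij}\mathcal{E}_k)-(\mathcal{E}_k\psi_{ij})(\psi_{ik}\mathcal{E}_j)(\mathcal{E}_i\psi_{jk})$ equals $t_{ij}\,\mathrm{id}$ if $i=k$ and $i\cdot j=-1$, and $0$ otherwise. (4) Mixed relations: for $i\neq j$, $\sigma_{ij}\sigma'_{ji}=\mathrm{id}_{\mathcal{F}_j\mathcal{E}_i\mathbf{1}_\lambda}$ and $\sigma'_{ji}\sigma_{ij}=\mathrm{id}_{\mathcal{E}_i\mathcal{F}_j\mathbf{1}_\lambda}$. (5) Bubbles: for $m\ge 0$ let $\circlearrowright_{i,\lambda}(m)=\epsilon_{i,\lambda}(x_i^m\mathcal{F}_i)\eta'_{i,\lambda}$ (clockwise) and $\circlearrowleft_{i,\lambda}(m)=\epsilon'_{i,\lambda}(\mathcal{F}_ix_i^m)\eta_{i,\lambda}$ (counterclockwise), endomorphisms of $\mathbf{1}_\lambda$. Then for $m\geq 0$: $\circlearrowright_{i,\lambda}(m)=0$ if $m<\lambda_i-1$;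 $\circlearrowleft_{i,\lambda}(m)=0$ if $m<-\lambda_i-1$; $\circlearrowright_{i,\lambda}(\lambda_i-1)=\mathsf{c}^{+}_{i,\lambda}\mathrm{id}$ if $\lambda_i\ge1$; $\circlearrowleft_{i,\lambda}(-\lambda_i-1)=\mathsf{c}^{-}_{i,\lambda}\mathrm{id}$ if $\lambda_i\le-1$. Fake bubbles (formal symbols with negative $m$) are defined by $\circlearrowright_{i,\lambda}(\lambda_i-1)=\mathsf{c}^{+}_{i,\lambda}\mathrm{id}$ for $\lambda_i\le0$; $\circlearrowleft_{i,\lambda}(-\lambda_i-1)=\mathsf{c}^{-}_{i,\lambda}\mathrm{id}$ for $\lambda_i\ge0$; for $\lambda_i<0$, $0<j<-\lambda_i+1$: $\circlearrowright_{i,\lambda}(\lambda_i-1+j)=-\frac1{\mathsf{c}^{-}_{i,\lambda}}\sum_{x+y=j,\,y\ge1}\circlearrowright_{i,\lambda}(\lambda_i-1+x)\circlearrowleft_{i,\lambda}(-\lambda_i-1+y)$; for $\lambda_i>0$, $0<j<\lambda_i+1$: $\circlearrowleft_{i,\lambda}(-\lambda_i-1+j)=-\frac1{\mathsf{c}^{+}_{i,\lambda}}\sum_{x+y=j,\,x\ge1}\circlearrowright_{i,\lambda}(\lambda_i-1+x)\circlearrowleft_{i,\lambda}(-\lambda_i-1+y)$; both are $0$ for $j<0$. (Here $x,y\geq 0$.) Equivalently, bubbles satisfy the infinite Grassmannian relation $\big(\sum_{r\ge0}\circlearrowright_{i,\lambda}(\lambda_i-1+r)t^r\big)\big(\sum_{s\ge0}\circlearrowleft_{i,\lambda}(-\lambda_i-1+s)t^s\big)=-1/\beta_{i,\lambda}$.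 (6) $\mathfrak{sl}_2$ relations (sums over $f_1,f_2,f_3\ge0$, empty if the total is negative): $\mathrm{id}_{\mathcal{E}_i\mathcal{F}_i\mathbf{1}_\lambda}=\beta_{i,\lambda}\,\sigma'_{ii}\sigma_{ii}-\beta_{i,\lambda}\sum_{f_1+f_2+f_3=\lambda_i-1}(x_i^{f_3}\mathcal{F}_i)\eta'_{i,\lambda}\circ\circlearrowleft_{i,\lambda}(-\lambda_i-1+f_2)\circ\epsilon_{i,\lambda}(x_i^{f_1}\mathcal{F}_i)$, $\mathrm{id}_{\mathcal{F}_i\mathcal{E}_i\mathbf{1}_\lambda}=\beta_{i,\lambda}\,\sigma_{ii}\sigma'_{ii}-\beta_{i,\lambda}\sum_{f_1+f_2+f_3=-\lambda_i-1}(\mathcal{F}_ix_i^{f_3})\eta_{i,\lambda}\circ\circlearrowright_{i,\lambda}(\lambda_i-1+f_2)\circ\epsilon'_{i,\lambda}(\mathcal{F}_ix_i^{f_1})$.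
   Formalization: It is assumed that the stated rescaling of dots and crossings is an algebra isomorphism R_Q→R_{Q'}; this forces t_ij=t'_ij for distinct vertices i,j of equal level, where γ_ij=γ_ji=1, and without it the formulas violate ψ_jiψ_ij=t_ij id. *)

theory Defs
  imports Complex_Main "HOL-Library.Poly_Mapping"
begin

section \<open>Cartan data and parameters\<close>

text \<open>
  The form takes values in an arbitrary field of characteristic zero: on fundamental
  weights it is not integral in general (already $(\Lambda,\Lambda) = 1/2$ for
  $\mathfrak{sl}_2$). The numbers $i\cdot j = (\alpha_i,\alpha_j)$ are integers and are available
  as the Cartan integers $\langle h_i,\alpha_j\rangle$.
\<close>

record ('x, 'i, 'q) cartan =
  rt :: "'i \<Rightarrow> 'x"
  fund :: "'i \<Rightarrow> 'x"
  coroot :: "'i \<Rightarrow> 'x \<Rightarrow> int"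
  form :: "'x \<Rightarrow> 'x \<Rightarrow> 'q"

definition free_Z_module :: "'x::ab_group_add itself \<Rightarrow> bool" where
  "free_Z_module _ \<longleftrightarrow> (\<exists>(scale :: int \<Rightarrow> 'x \<Rightarrow> 'x) B.
     module scale \<and> \<not> module.dependent scale B \<and> module.span scale B = UNIV)"

locale cartan_datum =
  fixes C :: "('x::ab_group_add, 'i, 'q::field_char_0) cartan"
  assumes free: "free_Z_module TYPE('x)"
    and coroot_add: "coroot C i (x + y) = coroot C i x + coroot C i y"
    and form_add_left: "form C (x + y) z = form C x z + form C y z"
    and form_add_right: "form C x (y + z) = form C x y + form C x z"
    and form_rt_sym: "form C (rt C i) (rt C j) = form C (rt C j) (rt C i)"
    and form_rt_same: "form C (rt C i) (rt C i) = 2"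
    and form_rt_diff: "i \<noteq> j \<Longrightarrow> form C (rt C i) (rt C j) \<in> {0, -1}"
    and coroot_form: "of_int (coroot C i x) = form C (rt C i) x"
    and coroot_fund: "coroot C j (fund C i) = (if i = j then 1 else 0)"

definition cdot :: "('x, 'i, 'q) cartan \<Rightarrow> 'i \<Rightarrow> 'i \<Rightarrow> int" where
  "cdot C i j = coroot C i (rt C j)"

text \<open>
  The field \<open>scal\<close> is only used off the diagonal; \<open>tt\<close> adds the convention
  $t_{ii} = -\beta_i$.
\<close>

record ('x, 'i, 'k) params =
  scal :: "'i \<Rightarrow> 'i \<Rightarrow> 'k"
  bub :: "'i \<Rightarrow> 'k"
  cpl :: "'i \<Rightarrow> 'x \<Rightarrow> 'k"
  cmi :: "'i \<Rightarrow> 'x \<Rightarrow> 'k"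

definition tt :: "('x, 'i, 'k::field) params \<Rightarrow> 'i \<Rightarrow> 'i \<Rightarrow> 'k" where
  "tt P i j = (if i = j then - bub P i else scal P i j)"

definition choice_of_scalars ::
    "('x, 'i, 'q) cartan \<Rightarrow> ('x, 'i, 'k::field) params \<Rightarrow> bool" where
  "choice_of_scalars C P \<longleftrightarrow>
     (\<forall>i j. i \<noteq> j \<longrightarrow> tt P i j \<noteq> 0 \<and> (cdot C i j = 0 \<longrightarrow> tt P i j = tt P j i))"

definition bubble_parameters :: "('x, 'i, 'k::field) params \<Rightarrow> bool" where
  "bubble_parameters P \<longleftrightarrow>
     (\<forall>i. bub P i \<noteq> 0) \<and> (\<forall>i x. cpl P i x \<noteq> 0 \<and> cmi P i x \<noteq> 0)"

definition compatible_params ::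
    "('x::ab_group_add, 'i, 'q) cartan \<Rightarrow> ('x, 'i, 'k::field) params \<Rightarrow> bool" where
  "compatible_params C P \<longleftrightarrow>
     (\<forall>i x. cpl P i x * cmi P i x = - 1 / bub P i) \<and>
     (\<forall>i j x. cpl P i (x + rt C j) = tt P i j * cpl P i x) \<and>
     (\<forall>i j x. cmi P i (x - rt C j) = tt P i j * cmi P i x)"


section \<open>The rooted tree and the scalars attached to it\<close>

definition adj :: "('x, 'i, 'q) cartan \<Rightarrow> 'i \<Rightarrow> 'i \<Rightarrow> bool" where
  "adj C i j \<longleftrightarrow> i \<noteq> j \<and> cdot C i j = -1"

definition graph_cycle :: "('x, 'i, 'q) cartan \<Rightarrow> 'i list \<Rightarrow> bool" where
  "graph_cycle C p \<longleftrightarrow>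
     length p \<ge> 3 \<and> distinct p \<and> successively (adj C) p \<and> adj C (last p) (hd p)"

definition graph_is_tree :: "('x, 'i, 'q) cartan \<Rightarrow> bool" where
  "graph_is_tree C \<longleftrightarrow> (\<forall>i j. (adj C)\<^sup>*\<^sup>* i j) \<and> \<not> (\<exists>p. graph_cycle C p)"

definition level :: "('x, 'i, 'q) cartan \<Rightarrow> 'i \<Rightarrow> 'i \<Rightarrow> nat" where
  "level C r i = (LEAST n. (adj C ^^ n) r i)"

definition lower :: "('x, 'i, 'q) cartan \<Rightarrow> 'i \<Rightarrow> 'i \<Rightarrow> 'i \<Rightarrow> bool" where
  "lower C r i j \<longleftrightarrow> level C r i < level C r j"

definition directed_edge :: "('x, 'i, 'q) cartan \<Rightarrow> 'i \<Rightarrow> 'i \<Rightarrow> 'i \<Rightarrow> bool" where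
  "directed_edge C r i j \<longleftrightarrow> adj C i j \<and> lower C r i j"

text \<open>The directed path from \<open>r\<close> to \<open>i\<close>, as its list of vertices.\<close>

definition path_to :: "('x, 'i, 'q) cartan \<Rightarrow> 'i \<Rightarrow> 'i \<Rightarrow> 'i list" where
  "path_to C r i =
     (THE p. p \<noteq> [] \<and> hd p = r \<and> last p = i \<and> successively (directed_edge C r) p)"

definition vv :: "('x, 'i, 'k::field) params \<Rightarrow> 'i \<Rightarrow> 'i \<Rightarrow> 'k" where
  "vv P i j = inverse (tt P i j) * tt P j i"

definition DD :: "('x, 'i, 'q) cartan \<Rightarrow> ('x, 'i, 'k::field) params \<Rightarrow> ('x, 'i, 'k) params \<Rightarrow>
    'i \<Rightarrow> 'i \<Rightarrow> 'k" where
  "DD C P P' r i =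
     (let p = path_to C r i in (\<Prod>(s, t)\<leftarrow>zip p (tl p). vv P' s t * vv P t s))"

definition gam :: "('x, 'i, 'q) cartan \<Rightarrow> ('x, 'i, 'k::field) params \<Rightarrow> ('x, 'i, 'k) params \<Rightarrow>
    'i \<Rightarrow> 'i \<Rightarrow> 'i \<Rightarrow> 'k" where
  "gam C P P' r i j =
     (if i = j then inverse (DD C P P' r i)
      else if lower C r i j \<and> cdot C i j = -1 then tt P j i * inverse (tt P' j i) * DD C P P' r j
      else if lower C r i j \<and> cdot C i j = 0 then tt P i j * inverse (tt P' i j)
      else 1)"


section \<open>Linear combinations of string diagrams\<close>

text \<open>
  A 1-morphism $\mathcal{E}_{i}\mathcal{F}_{j}\cdots\mathbf{1}_\lambda$ is a word in the symbols
  \<open>E i\<close>, \<open>F i\<close> together with the weight $\lambda$ of its rightmost region.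
\<close>

datatype 'i letter = E 'i | F 'i

type_synonym 'i word = "'i letter list"

fun letter_wt :: "('x::ab_group_add, 'i, 'q) cartan \<Rightarrow> 'i letter \<Rightarrow> 'x" where
  "letter_wt C (E i) = rt C i"
| "letter_wt C (F i) = - rt C i"

definition wt :: "('x::ab_group_add, 'i, 'q) cartan \<Rightarrow> 'i word \<Rightarrow> 'x" where
  "wt C w = (\<Sum>a\<leftarrow>w. letter_wt C a)"

text \<open>
  The generators \<open>Dot\<close>, \<open>Cross\<close>, \<open>Eta\<close>, \<open>Eta'\<close>, \<open>Eps'\<close>, \<open>Eps\<close> stand for $x$, $\psi$, $\eta$,
  $\eta'$, $\epsilon'$, $\epsilon$. Their weight label is always the weight of the region on
  their right, hence is determined by the place where they occur.
\<close>

datatype 'i gen = Dot 'i | Cross 'i 'i | Eta 'i | Eta' 'i | Eps' 'i | Eps 'i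

fun gsrc :: "'i gen \<Rightarrow> 'i word" where
  "gsrc (Dot i) = [E i]"
| "gsrc (Cross i j) = [E i, E j]"
| "gsrc (Eta i) = []"
| "gsrc (Eta' i) = []"
| "gsrc (Eps' i) = [F i, E i]"
| "gsrc (Eps i) = [E i, F i]"

fun gtrg :: "'i gen \<Rightarrow> 'i word" where
  "gtrg (Dot i) = [E i]"
| "gtrg (Cross i j) = [E j, E i]"
| "gtrg (Eta i) = [F i, E i]"
| "gtrg (Eta' i) = [E i, F i]"
| "gtrg (Eps' i) = []"
| "gtrg (Eps i) = []"

fun gdeg :: "('x, 'i, 'q) cartan \<Rightarrow> 'x \<Rightarrow> 'i gen \<Rightarrow> int" where
  "gdeg C x (Dot i) = 2"
| "gdeg C x (Cross i j) = - cdot C i j"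
| "gdeg C x (Eta i) = 1 + coroot C i x"
| "gdeg C x (Eta' i) = 1 - coroot C i x"
| "gdeg C x (Eps' i) = 1 + coroot C i x"
| "gdeg C x (Eps i) = 1 - coroot C i x"

text \<open>
  A slice \<open>(l, g, u)\<close> is a generator whiskered by identities, $l\,g\,u$. A diagram is a list of
  slices in the order of vertical composition, the head being applied last; the empty list
  is an identity. Every composite of generators is, up to the interchange law, of this form.
\<close>

type_synonym 'i slice = "'i word \<times> 'i gen \<times> 'i word"
type_synonym 'i diagram = "'i slice list"

fun typed :: "'i word \<Rightarrow> 'i diagram \<Rightarrow> 'i word \<Rightarrow> bool" where
  "typed w [] w' \<longleftrightarrow> w = w'"
| "typed w ((l, g, u) # s) w' \<longleftrightarrow> w' = l @ gtrg g @ u \<and> typed w s (l @ gsrc g @ u)"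

definition ddeg :: "('x::ab_group_add, 'i, 'q) cartan \<Rightarrow> 'x \<Rightarrow> 'i diagram \<Rightarrow> int" where
  "ddeg C x s = (\<Sum>(l, g, u)\<leftarrow>s. gdeg C (x + wt C u) g)"

definition whisk_diagram :: "'i word \<Rightarrow> 'i diagram \<Rightarrow> 'i word \<Rightarrow> 'i diagram" where
  "whisk_diagram l s u = map (\<lambda>(l', g, u'). (l @ l', g, u' @ u)) s"

type_synonym ('i, 'k) lincomb = "'i diagram \<Rightarrow>\<^sub>0 'k"

definition pscale :: "'k::field \<Rightarrow> ('a \<Rightarrow>\<^sub>0 'k) \<Rightarrow> ('a \<Rightarrow>\<^sub>0 'k)" where
  "pscale c p = Poly_Mapping.map ((*) c) p"

definition lin_ext :: "('a \<Rightarrow> 'b) \<Rightarrow> ('a \<Rightarrow>\<^sub>0 'k::field) \<Rightarrow> ('b \<Rightarrow>\<^sub>0 'k)" where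
  "lin_ext f p =
     (\<Sum>a\<in>Poly_Mapping.keys p. Poly_Mapping.single (f a) (Poly_Mapping.lookup p a))"

definition dg :: "'i diagram \<Rightarrow> ('i, 'k::field) lincomb" where
  "dg s = Poly_Mapping.single s 1"

text \<open>Vertical composition, \<open>q\<close> after \<open>p\<close>.\<close>

definition vert :: "('i, 'k::field) lincomb \<Rightarrow> ('i, 'k) lincomb \<Rightarrow> ('i, 'k) lincomb" where
  "vert q p = (\<Sum>t\<in>Poly_Mapping.keys q. \<Sum>s\<in>Poly_Mapping.keys p.
     Poly_Mapping.single (t @ s) (Poly_Mapping.lookup q t * Poly_Mapping.lookup p s))"

definition whisk :: "'i word \<Rightarrow> ('i, 'k::field) lincomb \<Rightarrow> 'i word \<Rightarrow> ('i, 'k) lincomb" where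
  "whisk l p u = lin_ext (\<lambda>s. whisk_diagram l s u) p"

text \<open>
  Horizontal composition of \<open>q\<close>, with source word \<open>v\<close>, and \<open>p\<close>, with target word \<open>w'\<close>;
  \<open>q\<close> is on the left of \<open>p\<close>.
\<close>

definition horiz :: "'i word \<Rightarrow> 'i word \<Rightarrow> ('i, 'k::field) lincomb \<Rightarrow> ('i, 'k) lincomb \<Rightarrow>
    ('i, 'k) lincomb" where
  "horiz v w' q p = vert (whisk [] q w') (whisk v p [])"

definition context_comb :: "'i diagram \<Rightarrow> 'i word \<Rightarrow> ('i, 'k::field) lincomb \<Rightarrow> 'i word \<Rightarrow>
    'i diagram \<Rightarrow> ('i, 'k) lincomb" where
  "context_comb s2 l p u s1 = vert (dg s2) (vert (whisk l p u) (dg s1))"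


section \<open>The relations\<close>

text \<open>
  A relation \<open>R a b p q\<close> identifies the 2-morphisms \<open>p\<close> and \<open>q\<close> from the word \<open>a\<close> to the
  word \<open>b\<close>. The first one is the interchange law.
\<close>

inductive interchange ::
    "'i word \<Rightarrow> 'i word \<Rightarrow> ('i, 'k::field) lincomb \<Rightarrow> ('i, 'k) lincomb \<Rightarrow> bool" where
  "interchange (gsrc g @ m @ gsrc g') (gtrg g @ m @ gtrg g')
     (dg [([], g, m @ gtrg g'), (gsrc g @ m, g', [])])
     (dg [(gtrg g @ m, g', []), ([], g, m @ gsrc g')])"

inductive klr_rel :: "('x, 'i, 'q) cartan \<Rightarrow> ('x, 'i, 'k::field) params \<Rightarrow>
    'i word \<Rightarrow> 'i word \<Rightarrow> ('i, 'k) lincomb \<Rightarrow> ('i, 'k) lincomb \<Rightarrow> bool"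
  for C :: "('x, 'i, 'q) cartan" and P :: "('x, 'i, 'k::field) params" where
  quad_same:
    "klr_rel C P [E i, E i] [E i, E i] (dg [([], Cross i i, []), ([], Cross i i, [])]) 0"
| quad_far: "i \<noteq> j \<Longrightarrow> cdot C i j = 0 \<Longrightarrow>
    klr_rel C P [E i, E j] [E i, E j]
      (dg [([], Cross j i, []), ([], Cross i j, [])])
      (pscale (tt P i j) (dg []))"
| quad_adj: "i \<noteq> j \<Longrightarrow> cdot C i j = -1 \<Longrightarrow>
    klr_rel C P [E i, E j] [E i, E j]
      (dg [([], Cross j i, []), ([], Cross i j, [])])
      (pscale (tt P i j) (dg [([], Dot i, [E j])]) + pscale (tt P j i) (dg [([E i], Dot j, [])]))"
| nil_left:
    "klr_rel C P [E i, E i] [E i, E i]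
      (dg [([], Cross i i, []), ([], Dot i, [E i])] - dg [([E i], Dot i, []), ([], Cross i i, [])])
      (dg [])"
| nil_right:
    "klr_rel C P [E i, E i] [E i, E i]
      (dg [([], Dot i, [E i]), ([], Cross i i, [])] - dg [([], Cross i i, []), ([E i], Dot i, [])])
      (dg [])"
| slide_left: "i \<noteq> j \<Longrightarrow>
    klr_rel C P [E i, E j] [E j, E i]
      (dg [([], Cross i j, []), ([], Dot i, [E j])])
      (dg [([E j], Dot i, []), ([], Cross i j, [])])"
| slide_right: "i \<noteq> j \<Longrightarrow>
    klr_rel C P [E i, E j] [E j, E i]
      (dg [([], Dot j, [E i]), ([], Cross i j, [])])
      (dg [([], Cross i j, []), ([E i], Dot j, [])])"
| cubic:
    "klr_rel C P [E i, E j, E k] [E k, E j, E i]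
      (dg [([], Cross j k, [E i]), ([E j], Cross i k, []), ([], Cross i j, [E k])]
       - dg [([E k], Cross i j, []), ([], Cross i k, [E j]), ([E i], Cross j k, [])])
      (if i = k \<and> cdot C i j = -1 then pscale (tt P i j) (dg []) else 0)"

text \<open>The sideways crossings $\sigma_{ij}$ and $\sigma'_{ij}$.\<close>

definition sig :: "'i \<Rightarrow> 'i \<Rightarrow> 'i diagram" where
  "sig i j = [([F j, E i], Eps j, []), ([F j], Cross j i, [F j]), ([], Eta j, [E i, F j])]"

definition sig' :: "'i \<Rightarrow> 'i \<Rightarrow> 'i diagram" where
  "sig' i j = [([], Eps' i, [E j, F i]), ([F i], Cross j i, [F i]), ([F i, E j], Eta' i, [])]"

text \<open>Genuine bubbles: \<open>cw i m\<close> is clockwise and \<open>ccw i m\<close> counterclockwise, with \<open>m\<close> dots.\<close>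

definition cw :: "'i \<Rightarrow> nat \<Rightarrow> ('i, 'k::field) lincomb" where
  "cw i m = dg ([([], Eps i, [])] @ replicate m ([], Dot i, [F i]) @ [([], Eta' i, [])])"

definition ccw :: "'i \<Rightarrow> nat \<Rightarrow> ('i, 'k::field) lincomb" where
  "ccw i m = dg ([([], Eps' i, [])] @ replicate m ([F i], Dot i, []) @ [([], Eta i, [])])"

text \<open>
  \<open>cws C P x i n\<close> and \<open>ccws C P x i n\<close> are the bubbles of degree $2n$ in the region of weight
  \<open>x\<close>, with label \<open>x\<^sub>i - 1 + n\<close> and \<open>- x\<^sub>i - 1 + n\<close> respectively; they are
  fake if this label is negative. In the recursion for a fake bubble of one orientation, the
  bubbles of the other orientation are genuine.
\<close>

fun cws :: "('x, 'i, 'q) cartan \<Rightarrow> ('x, 'i, 'k::field) params \<Rightarrow> 'x \<Rightarrow> 'i \<Rightarrow> nat \<Rightarrow>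
    ('i, 'k) lincomb" where
  "cws C P x i n =
     (if coroot C i x - 1 + int n \<ge> 0 then cw i (nat (coroot C i x - 1 + int n))
      else if n = 0 then pscale (cpl P i x) (dg [])
      else pscale (- 1 / cmi P i x)
        (\<Sum>m<n. vert (cws C P x i m) (ccw i (nat (- coroot C i x - 1 + int (n - m))))))"

fun ccws :: "('x, 'i, 'q) cartan \<Rightarrow> ('x, 'i, 'k::field) params \<Rightarrow> 'x \<Rightarrow> 'i \<Rightarrow> nat \<Rightarrow>
    ('i, 'k) lincomb" where
  "ccws C P x i n =
     (if - coroot C i x - 1 + int n \<ge> 0 then ccw i (nat (- coroot C i x - 1 + int n))
      else if n = 0 then pscale (cmi P i x) (dg [])
      else pscale (- 1 / cpl P i x)
        (\<Sum>m<n. vert (cw i (nat (coroot C i x - 1 + int (n - m)))) (ccws C P x i m)))"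

declare cws.simps [simp del] ccws.simps [simp del]

text \<open>\<open>u_rel C P x\<close> collects the relations whose rightmost region has weight \<open>x\<close>.\<close>

inductive u_rel :: "('x, 'i, 'q) cartan \<Rightarrow> ('x, 'i, 'k::field) params \<Rightarrow> 'x \<Rightarrow>
    'i word \<Rightarrow> 'i word \<Rightarrow> ('i, 'k) lincomb \<Rightarrow> ('i, 'k) lincomb \<Rightarrow> bool"
  for C :: "('x, 'i, 'q) cartan" and P :: "('x, 'i, 'k::field) params" and x :: 'x where
  interchange: "interchange a b p q \<Longrightarrow> u_rel C P x a b p q"
| adj_E: "u_rel C P x [E i] [E i] (dg [([], Eps i, [E i]), ([E i], Eta i, [])]) (dg [])"
| adj_E': "u_rel C P x [E i] [E i] (dg [([E i], Eps' i, []), ([], Eta' i, [E i])]) (dg [])"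
| adj_F: "u_rel C P x [F i] [F i] (dg [([F i], Eps i, []), ([], Eta i, [F i])]) (dg [])"
| adj_F': "u_rel C P x [F i] [F i] (dg [([], Eps' i, [F i]), ([F i], Eta' i, [])]) (dg [])"
| cyclic_dot: "u_rel C P x [F i] [F i]
    (dg [([], Eps' i, [F i]), ([F i], Dot i, [F i]), ([F i], Eta' i, [])])
    (dg [([F i], Eps i, []), ([F i], Dot i, [F i]), ([], Eta i, [F i])])"
| cyclic_cross: "u_rel C P x [F i, F j] [F j, F i]
    (dg [([F j, F i], Eps j, []), ([F j, F i, E j], Eps i, [F j]),
         ([F j, F i], Cross i j, [F i, F j]),
         ([F j], Eta i, [E j, F i, F j]), ([], Eta j, [F i, F j])])
    (dg [([], Eps' i, [F j, F i]), ([F i], Eps' j, [E i, F j, F i]),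
         ([F i, F j], Cross i j, [F j, F i]),
         ([F i, F j, E i], Eta' j, [F i]), ([F i, F j], Eta' i, [])])"
| klr: "klr_rel C P a b p q \<Longrightarrow> u_rel C P x a b p q"
| mixed_FE: "i \<noteq> j \<Longrightarrow>
    u_rel C P x [F j, E i] [F j, E i] (vert (dg (sig i j)) (dg (sig' j i))) (dg [])"
| mixed_EF: "i \<noteq> j \<Longrightarrow>
    u_rel C P x [E i, F j] [E i, F j] (vert (dg (sig' j i)) (dg (sig i j))) (dg [])"
| cw_zero: "int m < coroot C i x - 1 \<Longrightarrow> u_rel C P x [] [] (cw i m) 0"
| ccw_zero: "int m < - coroot C i x - 1 \<Longrightarrow> u_rel C P x [] [] (ccw i m) 0"
| cw_one: "int m = coroot C i x - 1 \<Longrightarrow>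
    u_rel C P x [] [] (cw i m) (pscale (cpl P i x) (dg []))"
| ccw_one: "int m = - coroot C i x - 1 \<Longrightarrow>
    u_rel C P x [] [] (ccw i m) (pscale (cmi P i x) (dg []))"
| sl2_EF: "u_rel C P x [E i, F i] [E i, F i] (dg [])
    (pscale (bub P i) (vert (dg (sig' i i)) (dg (sig i i)))
     - pscale (bub P i) (\<Sum>(f1, f2, f3) | int (f1 + f2 + f3) = coroot C i x - 1.
         vert (dg (replicate f3 ([], Dot i, [F i]) @ [([], Eta' i, [])]))
           (vert (ccws C P x i f2)
             (dg ([([], Eps i, [])] @ replicate f1 ([], Dot i, [F i]))))))"
| sl2_FE: "u_rel C P x [F i, E i] [F i, E i] (dg [])
    (pscale (bub P i) (vert (dg (sig i i)) (dg (sig' i i)))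
     - pscale (bub P i) (\<Sum>(f1, f2, f3) | int (f1 + f2 + f3) = - coroot C i x - 1.
         vert (dg (replicate f3 ([F i], Dot i, []) @ [([], Eta i, [])]))
           (vert (cws C P x i f2)
             (dg ([([], Eps' i, [])] @ replicate f1 ([F i], Dot i, []))))))"


section \<open>KLR algebras\<close>

text \<open>
  Since \<open>I\<close> may be infinite, $R_Q$ is an algebra without unit (with the local units given by
  the diagrams of vertical strands).
\<close>

record ('k, 'a) lin_algebra =
  acarrier :: "'a set"
  aplus :: "'a \<Rightarrow> 'a \<Rightarrow> 'a"
  ascale :: "'k \<Rightarrow> 'a \<Rightarrow> 'a"
  atimes :: "'a \<Rightarrow> 'a \<Rightarrow> 'a"

definition algebra_iso ::
    "('k, 'a) lin_algebra \<Rightarrow> ('k, 'b) lin_algebra \<Rightarrow> ('a \<Rightarrow> 'b) \<Rightarrow> bool" where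
  "algebra_iso A B f \<longleftrightarrow> bij_betw f (acarrier A) (acarrier B) \<and>
     (\<forall>a\<in>acarrier A. \<forall>b\<in>acarrier A.
        f (aplus A a b) = aplus B (f a) (f b) \<and> f (atimes A a b) = atimes B (f a) (f b)) \<and>
     (\<forall>c. \<forall>a\<in>acarrier A. f (ascale A c a) = ascale B c (f a))"

definition up :: "'i list \<Rightarrow> 'i word" where
  "up is = map E is"

fun upward :: "'i gen \<Rightarrow> bool" where
  "upward (Dot i) = True"
| "upward (Cross i j) = True"
| "upward _ = False"

text \<open>
  A KLR diagram is a pair of its bottom sequence and a list of slices; the bottom sequence
  is recorded because the list of slices may be empty.
\<close>

definition klr_diagrams :: "'i list \<Rightarrow> 'i list \<Rightarrow> 'i diagram set" where
  "klr_diagrams is js = {s. typed (up is) s (up js) \<and> (\<forall>(l, g, u)\<in>set s. upward g)}"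

definition klr_combs :: "(('i list \<times> 'i diagram) \<Rightarrow>\<^sub>0 'k::field) set" where
  "klr_combs = {p. \<forall>(is, s)\<in>Poly_Mapping.keys p. \<exists>js. s \<in> klr_diagrams is js}"

text \<open>The product stacks the first factor on top of the second one.\<close>

definition klr_mult :: "(('i list \<times> 'i diagram) \<Rightarrow>\<^sub>0 'k::field) \<Rightarrow>
    (('i list \<times> 'i diagram) \<Rightarrow>\<^sub>0 'k) \<Rightarrow> (('i list \<times> 'i diagram) \<Rightarrow>\<^sub>0 'k)" where
  "klr_mult q p = (\<Sum>(js, t)\<in>Poly_Mapping.keys q. \<Sum>(is, s)\<in>Poly_Mapping.keys p.
     if s \<in> klr_diagrams is js
     then Poly_Mapping.single (is, t @ s)
            (Poly_Mapping.lookup q (js, t) * Poly_Mapping.lookup p (is, s))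
     else 0)"

definition at_bottom :: "'i list \<Rightarrow> ('i, 'k::field) lincomb \<Rightarrow>
    (('i list \<times> 'i diagram) \<Rightarrow>\<^sub>0 'k)" where
  "at_bottom is p = lin_ext (Pair is) p"

definition klr_ideal :: "('x, 'i, 'q) cartan \<Rightarrow> ('x, 'i, 'k::field) params \<Rightarrow>
    (('i list \<times> 'i diagram) \<Rightarrow>\<^sub>0 'k) set" where
  "klr_ideal C P = module.span pscale
     {at_bottom is (context_comb s2 l p u s1 - context_comb s2 l q u s1) |is js s2 l p q u s1 a b.
        (klr_rel C P a b p q \<or> interchange a b p q) \<and>
        typed (up is) s1 (l @ a @ u) \<and> typed (l @ b @ u) s2 (up js) \<and>
        at_bottom is (context_comb s2 l p u s1) \<in> klr_combs \<and>
        at_bottom is (context_comb s2 l q u s1) \<in> klr_combs}"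

definition klr_class :: "('x, 'i, 'q) cartan \<Rightarrow> ('x, 'i, 'k::field) params \<Rightarrow>
    (('i list \<times> 'i diagram) \<Rightarrow>\<^sub>0 'k) \<Rightarrow> (('i list \<times> 'i diagram) \<Rightarrow>\<^sub>0 'k) set" where
  "klr_class C P p = {q \<in> klr_combs. q - p \<in> klr_ideal C P}"

definition klr_algebra :: "('x, 'i, 'q) cartan \<Rightarrow> ('x, 'i, 'k::field) params \<Rightarrow>
    ('k, (('i list \<times> 'i diagram) \<Rightarrow>\<^sub>0 'k) set) lin_algebra" where
  "klr_algebra C P =
    \<lparr> acarrier = klr_class C P ` klr_combs,
      aplus = (\<lambda>A B. \<Union>a\<in>A. \<Union>b\<in>B. klr_class C P (a + b)),
      ascale = (\<lambda>c A. \<Union>a\<in>A. klr_class C P (pscale c a)),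
      atimes = (\<lambda>A B. \<Union>a\<in>A. \<Union>b\<in>B. klr_class C P (klr_mult a b)) \<rparr>"

definition klr_diagram :: "('x, 'i, 'q) cartan \<Rightarrow> ('x, 'i, 'k::field) params \<Rightarrow>
    'i list \<Rightarrow> 'i diagram \<Rightarrow> (('i list \<times> 'i diagram) \<Rightarrow>\<^sub>0 'k) set" where
  "klr_diagram C P is s = klr_class C P (Poly_Mapping.single (is, s) 1)"

text \<open>
  The isomorphism of KLR algebras multiplying each \<open>i\<close>-dot by $D_i$ and each crossing with
  bottom labels \<open>i\<close>, \<open>j\<close> by $\gamma_{ij}$.
\<close>

definition klr_gimel :: "('x, 'i, 'q) cartan \<Rightarrow> ('x, 'i, 'k::field) params \<Rightarrow>
    ('x, 'i, 'k) params \<Rightarrow> 'i \<Rightarrow>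
    ((('i list \<times> 'i diagram) \<Rightarrow>\<^sub>0 'k) set \<Rightarrow> (('i list \<times> 'i diagram) \<Rightarrow>\<^sub>0 'k) set) \<Rightarrow> bool" where
  "klr_gimel C P P' r f \<longleftrightarrow>
     algebra_iso (klr_algebra C P) (klr_algebra C P') f \<and>
     (\<forall>is. f (klr_diagram C P is []) = klr_diagram C P' is []) \<and>
     (\<forall>ls i us. f (klr_diagram C P (ls @ [i] @ us) [(up ls, Dot i, up us)])
        = ascale (klr_algebra C P') (DD C P P' r i)
            (klr_diagram C P' (ls @ [i] @ us) [(up ls, Dot i, up us)])) \<and>
     (\<forall>ls i j us. f (klr_diagram C P (ls @ [i, j] @ us) [(up ls, Cross i j, up us)])
        = ascale (klr_algebra C P') (gam C P P' r i j)
            (klr_diagram C P' (ls @ [i, j] @ us) [(up ls, Cross i j, up us)]))"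


section \<open>Graded additive linear 2-categories\<close>

text \<open>
  The data of a strict 2-category with \<open>k\<close>-linear Hom categories, a grading shift and
  (chosen) direct sums of 1-morphisms, the latter with their two inclusions.
\<close>

record ('o, 'f, 'm, 'k) two_cat =
  obj :: "'o set"
  mor1 :: "'o \<Rightarrow> 'o \<Rightarrow> 'f set"
  id1 :: "'o \<Rightarrow> 'f"
  comp1 :: "'f \<Rightarrow> 'f \<Rightarrow> 'f"
  shift1 :: "int \<Rightarrow> 'f \<Rightarrow> 'f"
  sum1 :: "'f \<Rightarrow> 'f \<Rightarrow> 'f"
  mor2 :: "'f \<Rightarrow> 'f \<Rightarrow> 'm set"
  id2 :: "'f \<Rightarrow> 'm"
  vcomp :: "'m \<Rightarrow> 'm \<Rightarrow> 'm"
  hcomp :: "'m \<Rightarrow> 'm \<Rightarrow> 'm"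
  plus2 :: "'m \<Rightarrow> 'm \<Rightarrow> 'm"
  scale2 :: "'k \<Rightarrow> 'm \<Rightarrow> 'm"
  shift2 :: "int \<Rightarrow> 'm \<Rightarrow> 'm"
  incl_l :: "'f \<Rightarrow> 'f \<Rightarrow> 'm"
  incl_r :: "'f \<Rightarrow> 'f \<Rightarrow> 'm"

definition two_functor :: "('o, 'f, 'm, 'k) two_cat \<Rightarrow> ('p, 'g, 'n, 'k) two_cat \<Rightarrow>
    ('o \<Rightarrow> 'p) \<Rightarrow> ('f \<Rightarrow> 'g) \<Rightarrow> ('m \<Rightarrow> 'n) \<Rightarrow> bool" where
  "two_functor A B F0 F1 F2 \<longleftrightarrow>
     (\<forall>a\<in>obj A. F0 a \<in> obj B \<and> F1 (id1 A a) = id1 B (F0 a)) \<and>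
     (\<forall>a\<in>obj A. \<forall>b\<in>obj A. \<forall>f\<in>mor1 A a b.
        F1 f \<in> mor1 B (F0 a) (F0 b) \<and>
        (\<forall>n. F1 (shift1 A n f) = shift1 B n (F1 f)) \<and>
        F2 (id2 A f) = id2 B (F1 f) \<and>
        (\<forall>c\<in>obj A. \<forall>g\<in>mor1 A b c. F1 (comp1 A g f) = comp1 B (F1 g) (F1 f))) \<and>
     (\<forall>a\<in>obj A. \<forall>b\<in>obj A. \<forall>f\<in>mor1 A a b. \<forall>g\<in>mor1 A a b.
        F1 (sum1 A f g) = sum1 B (F1 f) (F1 g) \<and>
        F2 (incl_l A f g) = incl_l B (F1 f) (F1 g) \<and>
        F2 (incl_r A f g) = incl_r B (F1 f) (F1 g) \<and>
        (\<forall>m\<in>mor2 A f g.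
           F2 m \<in> mor2 B (F1 f) (F1 g) \<and>
           (\<forall>n. F2 (shift2 A n m) = shift2 B n (F2 m)) \<and>
           (\<forall>c. F2 (scale2 A c m) = scale2 B c (F2 m)) \<and>
           (\<forall>m'\<in>mor2 A f g. F2 (plus2 A m m') = plus2 B (F2 m) (F2 m')) \<and>
           (\<forall>h\<in>mor1 A a b. \<forall>m'\<in>mor2 A g h. F2 (vcomp A m' m) = vcomp B (F2 m') (F2 m)) \<and>
           (\<forall>c\<in>obj A. \<forall>f'\<in>mor1 A b c. \<forall>g'\<in>mor1 A b c. \<forall>m'\<in>mor2 A f' g'.
              F2 (hcomp A m' m) = hcomp B (F2 m') (F2 m))))"

definition two_cat_iso :: "('o, 'f, 'm, 'k) two_cat \<Rightarrow> ('p, 'g, 'n, 'k) two_cat \<Rightarrow>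
    ('o \<Rightarrow> 'p) \<Rightarrow> ('f \<Rightarrow> 'g) \<Rightarrow> ('m \<Rightarrow> 'n) \<Rightarrow> bool" where
  "two_cat_iso A B F0 F1 F2 \<longleftrightarrow> two_functor A B F0 F1 F2 \<and>
     bij_betw F0 (obj A) (obj B) \<and>
     (\<forall>a\<in>obj A. \<forall>b\<in>obj A. bij_betw F1 (mor1 A a b) (mor1 B (F0 a) (F0 b)) \<and>
        (\<forall>f\<in>mor1 A a b. \<forall>g\<in>mor1 A a b. bij_betw F2 (mor2 A f g) (mor2 B (F1 f) (F1 g))))"


section \<open>The 2-category\<close>

text \<open>
  \<open>hom_null\<close> is spanned by the relations in arbitrary horizontal and vertical contexts. All
  relations are homogeneous, so the last two conditions only select those of degree \<open>d\<close>.
\<close>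

definition hom_combs :: "('x::ab_group_add, 'i, 'q) cartan \<Rightarrow> 'x \<Rightarrow> 'i word \<Rightarrow> 'i word \<Rightarrow> int \<Rightarrow>
    ('i, 'k::field) lincomb set" where
  "hom_combs C x w w' d = {p. \<forall>s\<in>Poly_Mapping.keys p. typed w s w' \<and> ddeg C x s = d}"

definition hom_null :: "('x::ab_group_add, 'i, 'q) cartan \<Rightarrow> ('x, 'i, 'k::field) params \<Rightarrow> 'x \<Rightarrow>
    'i word \<Rightarrow> 'i word \<Rightarrow> int \<Rightarrow> ('i, 'k) lincomb set" where
  "hom_null C P x w w' d = module.span pscale
     {context_comb s2 l p u s1 - context_comb s2 l q u s1 |s2 l p q u s1 a b.
        u_rel C P (x + wt C u) a b p q \<and>
        typed w s1 (l @ a @ u) \<and> typed (l @ b @ u) s2 w' \<and>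
        context_comb s2 l p u s1 \<in> hom_combs C x w w' d \<and>
        context_comb s2 l q u s1 \<in> hom_combs C x w w' d}"

text \<open>
  A 1-morphism \<open>(x, y, ws)\<close> from \<open>x\<close> to \<open>y\<close> is the formal direct sum of the
  $w\mathbf{1}_x\langle t\rangle$ for \<open>(w, t)\<close> in the list \<open>ws\<close>. A 2-morphism from \<open>f\<close> to \<open>g\<close> is a
  class of matrices whose entry in row \<open>a\<close> and column \<open>b\<close> goes from the \<open>b\<close>-th summand of
  \<open>f\<close> to the \<open>a\<close>-th summand of \<open>g\<close>; a 2-morphism
  $w\langle t\rangle \to w'\langle t'\rangle$ is a combination of diagrams of degree $t'-t$.
  The matrix entries outside the range of indices are zero.
\<close>

type_synonym ('x, 'i) onecell = "'x \<times> 'x \<times> ('i word \<times> int) list"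
type_synonym ('i, 'k) dmat = "nat \<Rightarrow> nat \<Rightarrow> ('i, 'k) lincomb"
type_synonym ('x, 'i, 'k) twocell =
  "('x, 'i) onecell \<times> ('x, 'i) onecell \<times> ('i, 'k) dmat set"

abbreviation osrc :: "('x, 'i) onecell \<Rightarrow> 'x" where "osrc f \<equiv> fst f"
abbreviation otrg :: "('x, 'i) onecell \<Rightarrow> 'x" where "otrg f \<equiv> fst (snd f)"
abbreviation summands :: "('x, 'i) onecell \<Rightarrow> ('i word \<times> int) list" where
  "summands f \<equiv> snd (snd f)"

definition onecells :: "('x::ab_group_add, 'i, 'q) cartan \<Rightarrow> 'x \<Rightarrow> 'x \<Rightarrow>
    ('x, 'i) onecell set" where
  "onecells C x y = {(x, y, ws) |ws. \<forall>(w, t)\<in>set ws. x + wt C w = y}"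

definition onecell_comp :: "('x, 'i) onecell \<Rightarrow> ('x, 'i) onecell \<Rightarrow> ('x, 'i) onecell" where
  "onecell_comp g f = (osrc f, otrg g,
     concat (map (\<lambda>(v, s). map (\<lambda>(w, t). (v @ w, s + t)) (summands f)) (summands g)))"

definition onecell_shift :: "int \<Rightarrow> ('x, 'i) onecell \<Rightarrow> ('x, 'i) onecell" where
  "onecell_shift n f = (osrc f, otrg f, map (\<lambda>(w, t). (w, t + n)) (summands f))"

definition onecell_sum :: "('x, 'i) onecell \<Rightarrow> ('x, 'i) onecell \<Rightarrow> ('x, 'i) onecell" where
  "onecell_sum f g = (osrc f, otrg f, summands f @ summands g)"

definition dmats :: "('x::ab_group_add, 'i, 'q) cartan \<Rightarrow> ('x, 'i) onecell \<Rightarrow>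
    ('x, 'i) onecell \<Rightarrow> ('i, 'k::field) dmat set" where
  "dmats C f g = {M. \<forall>a b.
     if a < length (summands g) \<and> b < length (summands f)
     then M a b \<in> hom_combs C (osrc f) (fst (summands f ! b)) (fst (summands g ! a))
            (snd (summands g ! a) - snd (summands f ! b))
     else M a b = 0}"

definition dclass :: "('x::ab_group_add, 'i, 'q) cartan \<Rightarrow> ('x, 'i, 'k::field) params \<Rightarrow>
    ('x, 'i) onecell \<Rightarrow> ('x, 'i) onecell \<Rightarrow> ('i, 'k) dmat \<Rightarrow> ('i, 'k) dmat set" where
  "dclass C P f g M = {N \<in> dmats C f g. \<forall>a < length (summands g). \<forall>b < length (summands f).
     N a b - M a b \<in> hom_null C P (osrc f) (fst (summands f ! b)) (fst (summands g ! a))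
       (snd (summands g ! a) - snd (summands f ! b))}"

definition dmat_unit :: "nat \<Rightarrow> nat \<Rightarrow> nat \<Rightarrow> ('i, 'k::field) dmat" where
  "dmat_unit a0 b0 n = (\<lambda>a b. if \<exists>k<n. a = a0 + k \<and> b = b0 + k then dg [] else 0)"

definition dmat_vert :: "nat \<Rightarrow> ('i, 'k::field) dmat \<Rightarrow> ('i, 'k) dmat \<Rightarrow> ('i, 'k) dmat" where
  "dmat_vert n N M = (\<lambda>a b. \<Sum>k<n. vert (N a k) (M k b))"

text \<open>
  The horizontal composition of \<open>N : f' \<rightarrow> g'\<close> and \<open>M : f \<rightarrow> g\<close> is a Kronecker product, in
  accordance with the order of the summands in \<open>onecell_comp\<close>.
\<close>

definition dmat_horiz :: "('x, 'i) onecell \<Rightarrow> ('x, 'i) onecell \<Rightarrow> ('x, 'i) onecell \<Rightarrow>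
    ('x, 'i) onecell \<Rightarrow> ('i, 'k::field) dmat \<Rightarrow> ('i, 'k) dmat \<Rightarrow> ('i, 'k) dmat" where
  "dmat_horiz f' g' f g N M = (\<lambda>a b.
     let m = length (summands g); n = length (summands f) in
     if a < length (summands g') * m \<and> b < length (summands f') * n
     then horiz (fst (summands f' ! (b div n))) (fst (summands g ! (a mod m)))
            (N (a div m) (b div n)) (M (a mod m) (b mod n))
     else 0)"

definition U_cat :: "('x::ab_group_add, 'i, 'q) cartan \<Rightarrow> ('x, 'i, 'k::field) params \<Rightarrow>
    ('x, ('x, 'i) onecell, ('x, 'i, 'k) twocell, 'k) two_cat" where
  "U_cat C P =
    \<lparr> obj = UNIV,
      mor1 = onecells C,
      id1 = (\<lambda>x. (x, x, [([], 0)])),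
      comp1 = onecell_comp,
      shift1 = onecell_shift,
      sum1 = onecell_sum,
      mor2 = (\<lambda>f g. {(f, g, dclass C P f g M) |M. M \<in> dmats C f g}),
      id2 = (\<lambda>f. (f, f, dclass C P f f (dmat_unit 0 0 (length (summands f))))),
      vcomp = (\<lambda>(g, h, B) (f, g', A).
        (f, h, \<Union>N\<in>B. \<Union>M\<in>A. dclass C P f h (dmat_vert (length (summands g)) N M))),
      hcomp = (\<lambda>(f', g', B) (f, g, A).
        (onecell_comp f' f, onecell_comp g' g,
         \<Union>N\<in>B. \<Union>M\<in>A. dclass C P (onecell_comp f' f) (onecell_comp g' g)
           (dmat_horiz f' g' f g N M))),
      plus2 = (\<lambda>(f, g, A) (f', g', B).
        (f, g, \<Union>M\<in>A. \<Union>N\<in>B. dclass C P f g (\<lambda>a b. M a b + N a b))),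
      scale2 = (\<lambda>c (f, g, A). (f, g, \<Union>M\<in>A. dclass C P f g (\<lambda>a b. pscale c (M a b)))),
      shift2 = (\<lambda>n (f, g, A). (onecell_shift n f, onecell_shift n g, A)),
      incl_l = (\<lambda>f g. (f, onecell_sum f g,
        dclass C P f (onecell_sum f g) (dmat_unit 0 0 (length (summands f))))),
      incl_r = (\<lambda>f g. (g, onecell_sum f g,
        dclass C P g (onecell_sum f g)
          (dmat_unit (length (summands f)) 0 (length (summands g))))) \<rparr>"

text \<open>The 2-morphism $w\mathbf{1}_x \to w'\mathbf{1}_x\langle d\rangle$ given by \<open>p\<close>.\<close>

definition cell :: "('x::ab_group_add, 'i, 'q) cartan \<Rightarrow> ('x, 'i, 'k::field) params \<Rightarrow> 'x \<Rightarrow>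
    'i word \<Rightarrow> 'i word \<Rightarrow> int \<Rightarrow> ('i, 'k) lincomb \<Rightarrow> ('x, 'i, 'k) twocell" where
  "cell C P x w w' d p =
     (let f = (x, x + wt C w, [(w, 0)]); g = (x, x + wt C w', [(w', d)]) in
      (f, g, dclass C P f g (\<lambda>a b. if a = 0 \<and> b = 0 then p else 0)))"

definition gen_cell :: "('x::ab_group_add, 'i, 'q) cartan \<Rightarrow> ('x, 'i, 'k::field) params \<Rightarrow> 'x \<Rightarrow>
    'i gen \<Rightarrow> ('x, 'i, 'k) twocell" where
  "gen_cell C P x g = cell C P x (gsrc g) (gtrg g) (gdeg C x g) (dg [([], g, [])])"

text \<open>
  Sending a KLR diagram to itself, with rightmost region of weight \<open>x\<close>, maps the
  homogeneous elements of $R_Q$ with given bottom and top sequences to 2-morphisms.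
  \<open>G\<close> extends \<open>f\<close> if it is compatible with these maps.
\<close>

definition extends_klr :: "('x::ab_group_add, 'i, 'q) cartan \<Rightarrow> ('x, 'i, 'k::field) params \<Rightarrow>
    ('x, 'i, 'k) params \<Rightarrow>
    ((('i list \<times> 'i diagram) \<Rightarrow>\<^sub>0 'k) set \<Rightarrow> (('i list \<times> 'i diagram) \<Rightarrow>\<^sub>0 'k) set) \<Rightarrow>
    (('x, 'i, 'k) twocell \<Rightarrow> ('x, 'i, 'k) twocell) \<Rightarrow> bool" where
  "extends_klr C P P' f G \<longleftrightarrow>
     (\<forall>x is js d p q.
        p \<in> hom_combs C x (up is) (up js) d \<longrightarrow> Poly_Mapping.keys p \<subseteq> klr_diagrams is js \<longrightarrow>
        q \<in> hom_combs C x (up is) (up js) d \<longrightarrow> Poly_Mapping.keys q \<subseteq> klr_diagrams is js \<longrightarrow>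
        f (klr_class C P (at_bottom is p)) = klr_class C P' (at_bottom is q) \<longrightarrow>
        G (cell C P x (up is) (up js) d p) = cell C P' x (up is) (up js) d q)"

end

theory Submission
  imports Defs
begin

text \<open>
  The functor multiplies every diagram by the product of the scalars prescribed for its
  generators, each taken at the weight of the region to its right. It sends the two sides of each
  defining relation to the same multiple of the two sides of the corresponding relation for the
  primed parameters, provided that $\gamma_{ii} = D_i^{-1}$ and, for $i \neq j$,
  $\gamma_{ij}\gamma_{ji}t'_{ij}$ is $t_{ij}$ if $i\cdot j = 0$ and $D_i t_{ij}$ if $i\cdot j = -1$.
  The inverse scalars satisfy the same conditions with the two sets of parameters exchanged, so
  the functor is invertible. The conditions themselves follow from the existence of the isomorphism
  of KLR algebras: apply it to the quadratic relation and compare coefficients in a two-dimensional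
  representation of $R_{Q'}$ in which $\psi_{ji}\psi_{ij}$ acts on $e_{ij}$ by $t'_{ij} \neq 0$.
  In particular, vertices $i \neq j$ of equal level, for which $\gamma_{ij} = \gamma_{ji} = 1$, have
  $t_{ij} = t'_{ij}$.
\<close>

section \<open>Linear combinations\<close>

text \<open>Before relations are imposed the diagrams form a basis, so the functor is a diagonal map
  there, and the question is whether both sides of each relation receive one common nonzero factor.
  This explains the scalars of cups and caps. With \<open>Eps'\<close> and \<open>Eta'\<close>
  fixed, biadjointness leaves only \<open>Eps\<close> to be chosen: \<open>Eta\<close> at weight
  \<lambda> must carry the inverse of the scalar of \<open>Eps\<close> at \<lambda> + \<alpha>_i.
  The scalar of \<open>Eps\<close> is dictated by the lowest clockwise bubble, and the
  counterclockwise bubbles come out right because compatibility ties c^- to c^+ at the neighbouring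
  weight. A separate obstacle is the passage from R_Q to the 2-category. The KLR isomorphism is a
  map on classes, known only through its values on generators, and an element of the KLR ideal is a
  sum of relations with arbitrary bottoms, tops and degrees, whereas a space of 2-morphisms admits
  only relations of its own type. A linear projection onto one type closes this gap; it works
  because every relation is homogeneous.\<close>

lemma lookup_pscale [simp]:
  "Poly_Mapping.lookup (pscale c p) a = c * Poly_Mapping.lookup p a"
  by (simp add: pscale_def Poly_Mapping.map.rep_eq when_def)

interpretation pscale: module "pscale :: 'k::field \<Rightarrow> ('a \<Rightarrow>\<^sub>0 'k) \<Rightarrow> ('a \<Rightarrow>\<^sub>0 'k)"
  by unfold_locales (auto intro!: poly_mapping_eqI simp: lookup_add algebra_simps)

lemma pscale_single [simp]: "pscale c (Poly_Mapping.single a b) = Poly_Mapping.single a (c * b)"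
  by (intro poly_mapping_eqI) (simp add: lookup_single when_def)

lemma keys_pscale: "c \<noteq> 0 \<Longrightarrow> Poly_Mapping.keys (pscale c p) = Poly_Mapping.keys p"
  by (auto simp: in_keys_iff)

lemma additive_zero:
  fixes f :: "'a::ab_group_add \<Rightarrow> 'b::ab_group_add"
  assumes "\<And>p q. f (p + q) = f p + f q"
  shows "f 0 = 0"
  using assms[of 0 0] by simp

lemma additive_diff:
  fixes f :: "'a::ab_group_add \<Rightarrow> 'b::ab_group_add"
  assumes "\<And>p q. f (p + q) = f p + f q"
  shows "f (p - q) = f p - f q"
  using assms[of "p - q" q] by simp

lemma additive_sum:
  fixes f :: "'a::ab_group_add \<Rightarrow> 'b::ab_group_add"
  assumes "\<And>p q. f (p + q) = f p + f q"
  shows "f (\<Sum>a\<in>A. g a) = (\<Sum>a\<in>A. f (g a))"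
  using sum_comp_morphism[of f g A] additive_zero[of f, OF assms] assms by simp

lemma poly_mapping_eq_sum_single:
  "p = (\<Sum>a\<in>Poly_Mapping.keys p. Poly_Mapping.single a (Poly_Mapping.lookup p a))"
  by (intro poly_mapping_eqI) (simp add: lookup_sum lookup_single when_def in_keys_iff)

text \<open>The coefficient \<open>b\<close> is arbitrary, so additivity alone reduces an identity
  of linear maps to basis elements. Restricting to the support of \<open>p\<close> makes typing
  facts about its diagrams available.\<close>

lemma additive_eqI_keys:
  fixes f g :: "('a \<Rightarrow>\<^sub>0 'b::ab_group_add) \<Rightarrow> 'c::ab_group_add"
  assumes "\<And>p q. f (p + q) = f p + f q" "\<And>p q. g (p + q) = g p + g q"
    and "\<And>a b. a \<in> Poly_Mapping.keys p \<Longrightarrow> f (Poly_Mapping.single a b) = g (Poly_Mapping.single a b)"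
  shows "f p = g p"
  by (subst (1 2) poly_mapping_eq_sum_single)
    (simp add: additive_sum[of f, OF assms(1)] additive_sum[of g, OF assms(2)] assms(3))

lemma sum_keys_superset:
  fixes h :: "'a \<Rightarrow> 'b::zero \<Rightarrow> 'c::comm_monoid_add"
  assumes "finite A" "Poly_Mapping.keys p \<subseteq> A" "\<And>a. h a 0 = 0"
  shows "(\<Sum>a\<in>Poly_Mapping.keys p. h a (Poly_Mapping.lookup p a)) =
    (\<Sum>a\<in>A. h a (Poly_Mapping.lookup p a))"
  using assms by (intro sum.mono_neutral_left) (auto simp: in_keys_iff)

text \<open>Cancellation can make the support of \<open>p + q\<close> smaller than the union of the
  supports; since \<open>h a 0 = 0\<close>, all three sums may be taken over that union.\<close>

lemma sum_keys_add:
  fixes h :: "'a \<Rightarrow> 'b::ab_group_add \<Rightarrow> 'c::comm_monoid_add"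
  assumes h0: "\<And>a. h a 0 = 0" and h_add: "\<And>a b c. h a (b + c) = h a b + h a c"
  shows "(\<Sum>a\<in>Poly_Mapping.keys (p + q). h a (Poly_Mapping.lookup (p + q) a)) =
    (\<Sum>a\<in>Poly_Mapping.keys p. h a (Poly_Mapping.lookup p a)) +
    (\<Sum>a\<in>Poly_Mapping.keys q. h a (Poly_Mapping.lookup q a))"
proof -
  let ?A = "Poly_Mapping.keys p \<union> Poly_Mapping.keys q"
  have eq: "(\<Sum>a\<in>Poly_Mapping.keys f. h a (Poly_Mapping.lookup f a)) =
      (\<Sum>a\<in>?A. h a (Poly_Mapping.lookup f a))" if "Poly_Mapping.keys f \<subseteq> ?A" for f
    by (rule sum_keys_superset) (simp_all add: that h0)
  show ?thesis
    unfolding eq[OF keys_add] eq[OF Un_upper1] eq[OF Un_upper2]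
    by (simp add: lookup_add h_add sum.distrib)
qed

lemma sum_keys_single:
  assumes "\<And>a. h a 0 = 0"
  shows "(\<Sum>k\<in>Poly_Mapping.keys (Poly_Mapping.single a b). h k (Poly_Mapping.lookup (Poly_Mapping.single a b) k)) = h a b"
  using assms by (cases "b = 0") auto

lemma lin_ext_add: "lin_ext f (p + q) = lin_ext f p + lin_ext f q"
  unfolding lin_ext_def by (rule sum_keys_add) (simp_all add: single_add)

lemma lin_ext_single [simp]: "lin_ext f (Poly_Mapping.single a b) = Poly_Mapping.single (f a) b"
  unfolding lin_ext_def by (rule sum_keys_single) simp

lemma vert_add_left: "vert (q + q') p = vert q p + vert q' p"
  unfolding vert_def
  by (rule sum_keys_add) (simp_all add: single_add algebra_simps sum.distrib)

lemma vert_add_right: "vert q (p + p') = vert q p + vert q p'"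
  unfolding vert_def sum.distrib[symmetric]
  by (intro sum.cong refl sum_keys_add) (simp_all add: single_add algebra_simps)

lemma vert_single [simp]:
  "vert (Poly_Mapping.single t b) (Poly_Mapping.single s c) = Poly_Mapping.single (t @ s) (b * c)"
  unfolding vert_def
  by (subst sum_keys_single, simp) (rule sum_keys_single, simp)

lemmas lin_ext_zero [simp] = additive_zero[of "lin_ext f" for f, OF lin_ext_add]
lemmas lin_ext_diff = additive_diff[of "lin_ext f" for f, OF lin_ext_add]

lemma lin_ext_pscale: "lin_ext f (pscale c p) = pscale c (lin_ext f p)"
  by (rule additive_eqI_keys[of "\<lambda>p. lin_ext f (pscale c p)"])
    (simp_all add: lin_ext_add pscale.scale_right_distrib)

lemma vert_pscale_left: "vert (pscale c q) p = pscale c (vert q p)"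
  by (rule additive_eqI_keys[of "\<lambda>q. vert (pscale c q) p"],
      simp_all add: vert_add_left pscale.scale_right_distrib)
    (rule additive_eqI_keys[of "vert _"],
      simp_all add: vert_add_right pscale.scale_right_distrib mult.assoc)

lemma vert_pscale_right: "vert q (pscale c p) = pscale c (vert q p)"
  by (rule additive_eqI_keys[of "\<lambda>q. vert q (pscale c p)"],
      simp_all add: vert_add_left pscale.scale_right_distrib)
    (rule additive_eqI_keys[of "\<lambda>p. vert _ (pscale c p)"],
      simp_all add: vert_add_right pscale.scale_right_distrib mult.left_commute)

text \<open>The diagonal operator with eigenvalues \<open>c\<close>. Zero eigenvalues are allowed,
  so the same operator also serves as a projection onto part of the basis.\<close>

definition rescale :: "('a \<Rightarrow> 'k::field) \<Rightarrow> ('a \<Rightarrow>\<^sub>0 'k) \<Rightarrow> ('a \<Rightarrow>\<^sub>0 'k)" where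
  "rescale c p = Poly_Mapping.mapp (\<lambda>a. (*) (c a)) p"

lemma lookup_rescale [simp]:
  "Poly_Mapping.lookup (rescale c p) a = c a * Poly_Mapping.lookup p a"
  by (simp add: rescale_def lookup_mapp when_def in_keys_iff)

lemma rescale_single [simp]:
  "rescale c (Poly_Mapping.single a b) = Poly_Mapping.single a (c a * b)"
  by (intro poly_mapping_eqI) (simp add: lookup_single when_def)

lemma rescale_add: "rescale c (p + q) = rescale c p + rescale c q"
  by (intro poly_mapping_eqI) (simp add: lookup_add algebra_simps)

lemmas rescale_zero [simp] = additive_zero[of "rescale c" for c, OF rescale_add]
lemmas rescale_diff = additive_diff[of "rescale c" for c, OF rescale_add]
lemmas rescale_sum = additive_sum[of "rescale c" for c, OF rescale_add]

lemma rescale_pscale: "rescale c (pscale d p) = pscale d (rescale c p)"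
  by (intro poly_mapping_eqI) simp

lemma keys_rescale: "Poly_Mapping.keys (rescale c p) = {a \<in> Poly_Mapping.keys p. c a \<noteq> 0}"
  by (auto simp: in_keys_iff)

lemma rescale_inverse:
  assumes "\<And>a. c a \<noteq> 0"
  shows "rescale (\<lambda>a. inverse (c a)) (rescale c p) = p"
    and "rescale c (rescale (\<lambda>a. inverse (c a)) p) = p"
  by (intro poly_mapping_eqI; simp add: assms field_simps)+

lemma rescale_vert:
  assumes "\<And>t s. c (t @ s) = c t * c s"
  shows "rescale c (vert q p) = vert (rescale c q) (rescale c p)"
  by (rule additive_eqI_keys[of "\<lambda>q. rescale c (vert q p)"],
      simp_all add: vert_add_left rescale_add)
    (rule additive_eqI_keys[of "\<lambda>p. rescale c (vert _ p)"],
      simp_all add: vert_add_right rescale_add assms mult.assoc mult.left_commute)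

lemma rescale_lin_ext:
  assumes "\<And>a. c (f a) = d a"
  shows "rescale c (lin_ext f p) = lin_ext f (rescale d p)"
  by (rule additive_eqI_keys[of "\<lambda>p. rescale c (lin_ext f p)"])
    (simp_all add: lin_ext_add rescale_add assms)

lemma context_comb_pscale: "context_comb s2 l (pscale c p) u s1 = pscale c (context_comb s2 l p u s1)"
  by (simp add: context_comb_def whisk_def lin_ext_pscale vert_pscale_left vert_pscale_right)

lemma context_comb_add:
  "context_comb s2 l (p + q) u s1 = context_comb s2 l p u s1 + context_comb s2 l q u s1"
  by (simp add: context_comb_def whisk_def lin_ext_add vert_add_left vert_add_right)

text \<open>The target is an arbitrary subspace, so one induction covers maps between spans of
  relations, stability of ideals, and vanishing (\<open>V = {0}\<close>).\<close>

lemma span_induct_map: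
  fixes f :: "('a \<Rightarrow>\<^sub>0 'k::field) \<Rightarrow> ('b \<Rightarrow>\<^sub>0 'k)"
  assumes "z \<in> module.span pscale S"
    and add: "\<And>p q. f (p + q) = f p + f q" and scale: "\<And>c p. f (pscale c p) = pscale c (f p)"
    and V: "module.subspace pscale V"
    and base: "\<And>z. z \<in> S \<Longrightarrow> f z \<in> V"
  shows "f z \<in> V"
  using assms(1)
proof (induction rule: pscale.span_induct_alt)
  case base
  show ?case
    using additive_zero[of f, OF add] pscale.subspace_0[OF V] by simp
next
  case (step c z w)
  then show ?case
    using base pscale.subspace_add[OF V] pscale.subspace_scale[OF V] by (simp add: add scale)
qed

section \<open>Rescaling diagrams\<close>

lemma wt_Nil [simp]: "wt C [] = 0"
  and wt_Cons [simp]: "wt C (a # w) = letter_wt C a + wt C w"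
  and wt_append [simp]: "wt C (v @ w) = wt C v + wt C w"
  by (simp_all add: wt_def)

lemma wt_gsrc: "wt C (gsrc g) = wt C (gtrg g)"
  by (cases g) simp_all

text \<open>\<open>D\<close> and \<open>G\<close> are left abstract instead of being the tree
  scalars, so that the inverse functor is another instance, with inverted scalars and exchanged
  parameters.\<close>

fun gen_scale :: "('x::ab_group_add, 'i, 'q) cartan \<Rightarrow> ('x, 'i, 'k::field) params \<Rightarrow>
    ('x, 'i, 'k) params \<Rightarrow> ('i \<Rightarrow> 'k) \<Rightarrow> ('i \<Rightarrow> 'i \<Rightarrow> 'k) \<Rightarrow> 'x \<Rightarrow> 'i gen \<Rightarrow> 'k" where
  "gen_scale C P P' D G x (Dot i) = D i"
| "gen_scale C P P' D G x (Cross i j) = G i j"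
| "gen_scale C P P' D G x (Eta i) =
    D i powi (coroot C i x + 1) * (cpl P' i (x + rt C i) / cpl P i (x + rt C i))"
| "gen_scale C P P' D G x (Eps i) = D i powi (- coroot C i x + 1) * (cpl P i x / cpl P' i x)"
| "gen_scale C P P' D G x (Eta' i) = 1"
| "gen_scale C P P' D G x (Eps' i) = 1"

definition diagram_scale :: "('x::ab_group_add, 'i, 'q) cartan \<Rightarrow> ('x, 'i, 'k::field) params \<Rightarrow>
    ('x, 'i, 'k) params \<Rightarrow> ('i \<Rightarrow> 'k) \<Rightarrow> ('i \<Rightarrow> 'i \<Rightarrow> 'k) \<Rightarrow> 'x \<Rightarrow> 'i diagram \<Rightarrow> 'k" where
  "diagram_scale C P P' D G x s =
    (\<Prod>(l, g, u)\<leftarrow>s. gen_scale C P P' D G (x + wt C u) g)"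

lemma diagram_scale_Nil [simp]: "diagram_scale C P P' D G x [] = 1"
  and diagram_scale_Cons [simp]: "diagram_scale C P P' D G x ((l, g, u) # s) =
    gen_scale C P P' D G (x + wt C u) g * diagram_scale C P P' D G x s"
  and diagram_scale_append [simp]: "diagram_scale C P P' D G x (s @ t) =
    diagram_scale C P P' D G x s * diagram_scale C P P' D G x t"
  by (simp_all add: diagram_scale_def)

lemma diagram_scale_replicate [simp]: "diagram_scale C P P' D G x (replicate n (l, g, u)) =
    gen_scale C P P' D G (x + wt C u) g ^ n"
  by (induction n) simp_all

lemma diagram_scale_whisk_diagram:
  "diagram_scale C P P' D G x (whisk_diagram l s u) = diagram_scale C P P' D G (x + wt C u) s"
  by (induction s) (auto simp: whisk_diagram_def add_ac)

lemma rescale_whisk: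
  "rescale (diagram_scale C P P' D G x) (whisk l p u) =
    whisk l (rescale (diagram_scale C P P' D G (x + wt C u)) p) u"
  unfolding whisk_def by (rule rescale_lin_ext) (simp add: diagram_scale_whisk_diagram)

lemma rescale_diagram_vert:
  "rescale (diagram_scale C P P' D G x) (vert q p) =
    vert (rescale (diagram_scale C P P' D G x) q) (rescale (diagram_scale C P P' D G x) p)"
  by (rule rescale_vert) simp

lemma rescale_dg [simp]: "rescale c (dg s) = pscale (c s) (dg s)"
  by (simp add: dg_def)

text \<open>Whiskering by \<open>u\<close> shifts the region to the right of \<open>p\<close>, so
  \<open>p\<close> is rescaled at the very weight at which \<open>hom_null\<close> imposes its
  relation; everything around it contributes a single scalar.\<close>

lemma rescale_context_comb:
  "rescale (diagram_scale C P P' D G x) (context_comb s2 l p u s1) =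
    pscale (diagram_scale C P P' D G x s2 * diagram_scale C P P' D G x s1)
      (context_comb s2 l (rescale (diagram_scale C P P' D G (x + wt C u)) p) u s1)"
  by (simp add: context_comb_def rescale_diagram_vert rescale_whisk vert_pscale_left
      vert_pscale_right mult.commute)

lemma rescale_horiz:
  "rescale (diagram_scale C P P' D G x) (horiz v w q p) =
    horiz v w (rescale (diagram_scale C P P' D G (x + wt C w)) q)
      (rescale (diagram_scale C P P' D G x) p)"
  by (simp add: horiz_def rescale_diagram_vert rescale_whisk)

section \<open>Cartan integers and the conditions on the scalars\<close>

context cartan_datum
begin

text \<open>The form has values in a field of characteristic zero, so statements about Cartan
  integers are proved there and pulled back along the injective \<open>of_int\<close>.\<close>

lemma cdot_same: "cdot C i i = 2"
proof -
  have "of_int (cdot C i i) = (of_int 2 :: 'q)"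
    unfolding cdot_def coroot_form by (simp add: form_rt_same)
  then show ?thesis
    by (simp only: of_int_eq_iff)
qed

lemma cdot_sym: "cdot C i j = cdot C j i"
proof -
  have "of_int (cdot C i j) = (of_int (cdot C j i) :: 'q)"
    unfolding cdot_def coroot_form by (rule form_rt_sym)
  then show ?thesis
    by (simp only: of_int_eq_iff)
qed

lemma cdot_cases: "i \<noteq> j \<Longrightarrow> cdot C i j = 0 \<or> cdot C i j = -1"
proof -
  assume "i \<noteq> j"
  then have "of_int (cdot C i j) \<in> {of_int 0, of_int (-1) :: 'q}"
    unfolding cdot_def coroot_form using form_rt_diff by simp
  then show ?thesis
    by (auto simp only: insert_iff empty_iff of_int_eq_iff)
qed

lemma coroot_rt_same [simp]: "coroot C i (rt C i) = 2"
  using cdot_same by (simp add: cdot_def)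

end

lemma params_tt_nonzero:
  assumes "choice_of_scalars C P" "bubble_parameters P"
  shows "tt P i j \<noteq> 0"
  using assms unfolding choice_of_scalars_def bubble_parameters_def
  by (cases "i = j") (simp_all add: tt_def)

text \<open>The left side of \<open>G_adj\<close> is symmetric up to t'. Taking it for (i,j) and
  (j,i) forces D_i t_ij / t'_ij = D_j t_ji / t'_ji, that is D_j = D_i v'_ij v_ji, the recursion
  along an edge behind the path product \<open>DD\<close>.\<close>

locale rescaling = cartan_datum C
  for C :: "('x::ab_group_add, 'i, 'q::field_char_0) cartan" +
  fixes P P' :: "('x, 'i, 'k::field) params" and D :: "'i \<Rightarrow> 'k" and G :: "'i \<Rightarrow> 'i \<Rightarrow> 'k"
  assumes params: "choice_of_scalars C P" "bubble_parameters P" "compatible_params C P"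
    and params': "choice_of_scalars C P'" "bubble_parameters P'" "compatible_params C P'"
    and D_nonzero: "D i \<noteq> 0" and G_nonzero: "G i j \<noteq> 0"
    and G_same: "G i i = inverse (D i)"
    and G_far: "i \<noteq> j \<Longrightarrow> cdot C i j = 0 \<Longrightarrow> G i j * G j i * tt P' i j = tt P i j"
    and G_adj: "i \<noteq> j \<Longrightarrow> cdot C i j = -1 \<Longrightarrow> G i j * G j i * tt P' i j = D i * tt P i j"
begin

lemma bub_nonzero: "bub P i \<noteq> 0" "bub P' i \<noteq> 0"
  and cpl_nonzero: "cpl P i x \<noteq> 0" "cpl P' i x \<noteq> 0"
  and cmi_nonzero: "cmi P i x \<noteq> 0" "cmi P' i x \<noteq> 0"
  using params params' by (simp_all add: bubble_parameters_def)

lemma tt_nonzero: "tt P i j \<noteq> 0" "tt P' i j \<noteq> 0"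
  by (rule params_tt_nonzero[OF params(1,2)], rule params_tt_nonzero[OF params'(1,2)])

lemma cpl_mult_cmi: "cpl P i x * cmi P i x = - 1 / bub P i" "cpl P' i x * cmi P' i x = - 1 / bub P' i"
  and cpl_add: "cpl P i (x + rt C j) = tt P i j * cpl P i x"
    "cpl P' i (x + rt C j) = tt P' i j * cpl P' i x"
  using params params' by (simp_all add: compatible_params_def)

text \<open>c^- is determined by c^+ and \<beta>, which is why scalars written with c^+ alone can
  control bubbles of both orientations.\<close>

lemma cmi_eq: "cmi P i x = - 1 / (bub P i * cpl P i x)" "cmi P' i x = - 1 / (bub P' i * cpl P' i x)"
proof -
  have "cmi P i x = cpl P i x * cmi P i x / cpl P i x" "cmi P' i x = cpl P' i x * cmi P' i x / cpl P' i x"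
    by (simp_all add: cpl_nonzero)
  then show "cmi P i x = - 1 / (bub P i * cpl P i x)" "cmi P' i x = - 1 / (bub P' i * cpl P' i x)"
    by (simp_all only: cpl_mult_cmi divide_divide_eq_left)
qed

abbreviation "gs \<equiv> gen_scale C P P' D G"
abbreviation "ds \<equiv> diagram_scale C P P' D G"

lemma gen_scale_nonzero: "gs x g \<noteq> 0"
  by (cases g) (simp_all add: D_nonzero G_nonzero cpl_nonzero)

lemma diagram_scale_nonzero: "ds x s \<noteq> 0"
  by (induction s) (auto simp: gen_scale_nonzero)

lemma rescaling_swap: "rescaling C P' P (\<lambda>i. inverse (D i)) (\<lambda>i j. inverse (G i j))"
proof
  fix i j
  show "inverse (G i j) * inverse (G j i) * tt P i j = tt P' i j"
    if "i \<noteq> j" "cdot C i j = 0"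
    using G_far[OF that] G_nonzero[of i j] G_nonzero[of j i] by (simp add: field_simps)
  show "inverse (G i j) * inverse (G j i) * tt P i j = inverse (D i) * tt P' i j"
    if "i \<noteq> j" "cdot C i j = -1"
    using G_adj[OF that] G_nonzero[of i j] G_nonzero[of j i] D_nonzero[of i]
    by (simp add: field_simps)
qed (use params params' in \<open>simp_all add: D_nonzero G_nonzero G_same\<close>)

lemma gen_scale_swap:
  "gen_scale C P' P (\<lambda>i. inverse (D i)) (\<lambda>i j. inverse (G i j)) x g = inverse (gs x g)"
  by (cases g) (simp_all add: power_int_inverse divide_inverse mult_ac)

lemma diagram_scale_swap:
  "diagram_scale C P' P (\<lambda>i. inverse (D i)) (\<lambda>i j. inverse (G i j)) x = (\<lambda>s. inverse (ds x s))"
proof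
  fix s
  show "diagram_scale C P' P (\<lambda>i. inverse (D i)) (\<lambda>i j. inverse (G i j)) x s = inverse (ds x s)"
    by (induction s) (auto simp: gen_scale_swap)
qed

text \<open>
  \<open>turn i j\<close> is the factor by which the scalar of the cap $\epsilon_i$ changes when the region to
  its right is shifted by $\alpha_j$. It equals $\gamma_{ij}\gamma_{ji}$ for $i \neq j$ and is thus
  symmetric in $i$ and $j$; cyclicity and the mixed relations reduce to these two facts.
\<close>

definition turn :: "'i \<Rightarrow> 'i \<Rightarrow> 'k" where
  "turn i j = D i powi (- cdot C i j) * (tt P i j / tt P' i j)"

lemma gen_scale_Eps_add: "gs (x + rt C j) (Eps i) = turn i j * gs x (Eps i)"
proof -
  have "D i powi (- coroot C i (x + rt C j) + 1) =
      D i powi (- cdot C i j) * D i powi (- coroot C i x + 1)"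
    by (subst power_int_add[symmetric]) (simp_all add: D_nonzero coroot_add cdot_def algebra_simps)
  then show ?thesis
    by (simp add: turn_def cpl_add)
qed

text \<open>In a zigzag the cap \<open>Eps i\<close> sits one root above the cup
  \<open>Eta i\<close>, and the zigzag must have scalar 1. The exponents of D_i agree because
  \<open>coroot C i\<close> grows by 2 along \<open>rt C i\<close>.\<close>

lemma gen_scale_Eta: "gs x (Eta i) = inverse (gs (x + rt C i) (Eps i))"
proof -
  have "D i powi (coroot C i x + 1) = inverse (D i powi (- coroot C i (x + rt C i) + 1))"
    by (subst power_int_minus[symmetric]) (simp add: coroot_add)
  then show ?thesis
    by (simp only: gen_scale.simps inverse_mult_distrib inverse_divide)
qed

lemma G_mult: "i \<noteq> j \<Longrightarrow> G i j * G j i = turn i j"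
  using cdot_cases[of i j] G_far[of i j] G_adj[of i j]
  by (auto simp: turn_def tt_nonzero nonzero_eq_divide_eq)

lemma turn_sym: "turn i j = turn j i"
  using G_mult[of i j] G_mult[of j i] by (cases "i = j") (simp_all add: mult.commute)

lemma turn_nonzero: "turn i j \<noteq> 0"
  by (simp add: turn_def tt_nonzero D_nonzero)

lemma turn_same: "turn i i = bub P i / (bub P' i * D i ^ 2)"
  by (simp add: turn_def cdot_same tt_def power_int_minus divide_inverse mult_ac)

text \<open>With n = \<lambda>_i - 1 dots the power of D_i disappears and c^+/c'^+ remains, the
  factor by which the prescribed value of the lowest clockwise bubble changes.\<close>

lemma gen_scale_Eps_dots:
  "gs x (Eps i) * D i ^ n = D i powi (- coroot C i x + 1 + int n) * (cpl P i x / cpl P' i x)"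
  by (simp add: power_int_add D_nonzero)

text \<open>Compatibility gives c^+ at \<lambda> + \<alpha>_i as t_ii c^+ = -\<beta>_i c^+ at
  \<lambda>, which equals 1/c^- at \<lambda>. The ratio of c^+ in the scalar of the cup is thus a
  ratio of c^- at the weight of the bubble.\<close>

lemma gen_scale_Eta_dots:
  "gs x (Eta i) * D i ^ n = D i powi (coroot C i x + 1 + int n) * (cmi P i x / cmi P' i x)"
proof -
  have "cpl P' i (x + rt C i) / cpl P i (x + rt C i) = cmi P i x / cmi P' i x"
    unfolding cpl_add cmi_eq by (simp add: tt_def cpl_nonzero bub_nonzero)
  moreover have "D i powi (coroot C i x + 1 + int n) = D i powi (coroot C i x + 1) * D i ^ n"
    by (subst power_int_add) (simp_all add: D_nonzero)
  ultimately show ?thesis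
    by (simp only: gen_scale.simps mult_ac)
qed

end

lemma hom_combs_pscale: "c \<noteq> 0 \<Longrightarrow> pscale c p \<in> hom_combs C x w w' d \<longleftrightarrow> p \<in> hom_combs C x w w' d"
  by (simp add: hom_combs_def keys_pscale)

section \<open>Invariance of the relations\<close>

context rescaling
begin

text \<open>The explicit scalars of \<open>Eta\<close> and \<open>Eps\<close> are hidden from the
  simplifier; instead \<open>weight_shift\<close> brings all of them to \<open>Eps\<close> scalars
  at a common weight, up to factors \<open>turn\<close>, so that they cancel as symbols.\<close>

lemmas [simp del] = gen_scale.simps(3,4)

lemma gen_scale_Eps_diff: "gs (x - rt C j) (Eps i) = gs x (Eps i) / turn i j"
  using gen_scale_Eps_add[of "x - rt C j" j i] by (simp add: turn_nonzero)

lemmas weight_shift = gen_scale_Eta gen_scale_Eps_add gen_scale_Eps_diff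

text \<open>The cap \<open>Eps j\<close> is taken at \<open>x\<close>, while the cup
  \<open>Eta j\<close> contributes the inverse of \<open>Eps j\<close> at \<open>x + rt C i\<close>,
  since the strand \<open>E i\<close> lies to its right. They cancel up to one \<open>turn\<close>.
  In \<open>sig'\<close> cup and cap have scalar 1.\<close>

lemma diagram_scale_sig: "ds x (sig i j) = G j i / turn j i"
  by (simp add: sig_def weight_shift algebra_simps)
    (simp add: gen_scale_nonzero turn_nonzero field_simps)

lemma diagram_scale_sig': "ds x (sig' i j) = G j i"
  by (simp add: sig'_def)

lemma rescale_cw: "rescale (ds x) (cw i m) =
    pscale (D i powi (- coroot C i x + 1 + int m) * (cpl P i x / cpl P' i x)) (cw i m)"
  unfolding gen_scale_Eps_dots[symmetric] by (simp add: cw_def)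

lemma rescale_ccw: "rescale (ds x) (ccw i m) =
    pscale (D i powi (coroot C i x + 1 + int m) * (cmi P i x / cmi P' i x)) (ccw i m)"
  unfolding gen_scale_Eta_dots[symmetric] by (simp add: ccw_def mult.commute)

text \<open>Genuine and fake bubbles obey one law in terms of the degree 2n. For fake ones the
  recursion is homogeneous in n, and the factor c^-/c'^- of the genuine counterclockwise bubble
  converts the coefficient 1/c^- into 1/c'^-.\<close>

lemma rescale_cws: "rescale (ds x) (cws C P x i n) =
    pscale (D i ^ n * (cpl P i x / cpl P' i x)) (cws C P' x i n)"
proof (induction n rule: less_induct)
  case (less n)
  consider "coroot C i x - 1 + int n \<ge> 0" | "coroot C i x - 1 + int n < 0" "n = 0"
    | "coroot C i x - 1 + int n < 0" "n \<noteq> 0"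
    by linarith
  then show ?case
  proof cases
    case 1
    then show ?thesis
      by (simp add: cws.simps[of C _ x i n] rescale_cw)
  next
    case 2
    then show ?thesis
      by (simp add: cws.simps[of C _ x i 0] rescale_pscale cpl_nonzero)
  next
    case 3
    have cws_eq: "cws C Q x i n = pscale (- 1 / cmi Q i x)
        (\<Sum>m<n. vert (cws C Q x i m) (ccw i (nat (- coroot C i x - 1 + int (n - m)))))"
      for Q :: "('x, 'i, 'k) params"
      using 3 by (subst cws.simps) simp
    have summand: "rescale (ds x) (vert (cws C P x i m) (ccw i (nat (- coroot C i x - 1 + int (n - m))))) =
        pscale (D i ^ n * (cpl P i x / cpl P' i x) * (cmi P i x / cmi P' i x))
          (vert (cws C P' x i m) (ccw i (nat (- coroot C i x - 1 + int (n - m)))))"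
      if "m < n" for m
    proof -
      \<comment> \<open>No truncation by \<open>nat\<close> occurs: \<lambda>_i - 1 + n < 0 and n
        \<ge> 1 give -\<lambda>_i - 1 \<ge> 0.\<close>
      have "coroot C i x + 1 + int (nat (- coroot C i x - 1 + int (n - m))) = int (n - m)"
        using 3 that by simp
      then have "D i powi (coroot C i x + 1 + int (nat (- coroot C i x - 1 + int (n - m)))) = D i ^ (n - m)"
        by (simp only: power_int_of_nat)
      moreover have "D i ^ n = D i ^ m * D i ^ (n - m)"
        using that by (simp flip: power_add)
      ultimately show ?thesis
        using less.IH[OF that]
        by (simp only: rescale_diagram_vert rescale_ccw vert_pscale_left vert_pscale_right
            pscale.scale_scale mult_ac)
    qed
    show ?thesis
      unfolding cws_eq rescale_pscale rescale_sum
      by (subst sum.cong[OF refl summand])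
        (simp_all add: cmi_nonzero flip: pscale.scale_sum_right)
  qed
qed

lemma rescale_ccws: "rescale (ds x) (ccws C P x i n) =
    pscale (D i ^ n * (cmi P i x / cmi P' i x)) (ccws C P' x i n)"
proof (induction n rule: less_induct)
  case (less n)
  consider "- coroot C i x - 1 + int n \<ge> 0" | "- coroot C i x - 1 + int n < 0" "n = 0"
    | "- coroot C i x - 1 + int n < 0" "n \<noteq> 0"
    by linarith
  then show ?case
  proof cases
    case 1
    then show ?thesis
      by (simp add: ccws.simps[of C _ x i n] rescale_ccw)
  next
    case 2
    then show ?thesis
      by (simp add: ccws.simps[of C _ x i 0] rescale_pscale cmi_nonzero)
  next
    case 3
    have ccws_eq: "ccws C Q x i n = pscale (- 1 / cpl Q i x)
        (\<Sum>m<n. vert (cw i (nat (coroot C i x - 1 + int (n - m)))) (ccws C Q x i m))"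
      for Q :: "('x, 'i, 'k) params"
      using 3 by (subst ccws.simps) simp
    have summand: "rescale (ds x) (vert (cw i (nat (coroot C i x - 1 + int (n - m)))) (ccws C P x i m)) =
        pscale (D i ^ n * (cmi P i x / cmi P' i x) * (cpl P i x / cpl P' i x))
          (vert (cw i (nat (coroot C i x - 1 + int (n - m)))) (ccws C P' x i m))"
      if "m < n" for m
    proof -
      have "- coroot C i x + 1 + int (nat (coroot C i x - 1 + int (n - m))) = int (n - m)"
        using 3 that by simp
      then have "D i powi (- coroot C i x + 1 + int (nat (coroot C i x - 1 + int (n - m)))) = D i ^ (n - m)"
        by (simp only: power_int_of_nat)
      moreover have "D i ^ n = D i ^ m * D i ^ (n - m)"
        using that by (simp flip: power_add)
      ultimately show ?thesis
        using less.IH[OF that]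
        by (simp only: rescale_diagram_vert rescale_cw vert_pscale_left vert_pscale_right
            pscale.scale_scale mult_ac)
    qed
    show ?thesis
      unfolding ccws_eq rescale_pscale rescale_sum
      by (subst sum.cong[OF refl summand])
        (simp_all add: cpl_nonzero flip: pscale.scale_sum_right)
  qed
qed

text \<open>Both kinds of terms in an sl_2 relation scale by this ratio, the bubble sum by this
  identity and the double sideways crossing by \<open>G_mult_same\<close>. It turns the coefficient
  \<open>bub P i\<close> into \<open>bub P' i\<close>, so the identity on the other side keeps
  factor 1.\<close>

lemma cpl_cmi_ratio: "(cpl P i x / cpl P' i x) * (cmi P i x / cmi P' i x) = bub P' i / bub P i"
  by (simp add: cmi_eq cpl_nonzero)

lemma G_mult_same: "G i i / turn i i * G i i = bub P' i / bub P i"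
  by (simp add: turn_same G_same D_nonzero field_simps power2_eq_square)

lemma proportionalI:
  assumes "R a b p' q'" "c \<noteq> 0" "f p = pscale c p'" "f q = pscale c q'"
  shows "\<exists>c p' q'. c \<noteq> 0 \<and> f p = pscale c p' \<and> f q = pscale c q' \<and> R a b p' q'"
  using assms by blast

lemma klr_rel_rescale:
  assumes "klr_rel C P a b p q"
  shows "\<exists>c p' q'. c \<noteq> 0 \<and> rescale (ds x) p = pscale c p' \<and> rescale (ds x) q = pscale c q' \<and>
    klr_rel C P' a b p' q'"
  using assms
proof cases
  case (quad_same i)
  show ?thesis
    unfolding quad_same
    by (rule proportionalI[where R = "klr_rel C P'", OF klr_rel.quad_same[of _ _ i],
          where c = "G i i * G i i"]) (simp_all add: G_nonzero)
next
  case (quad_far i j)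
  have "G j i * G i j * tt P' i j = tt P i j"
    using G_far quad_far by (simp add: mult.commute)
  then show ?thesis
    unfolding quad_far(1-4)
    by (intro proportionalI[where R = "klr_rel C P'", OF klr_rel.quad_far[of i j],
          where c = "G j i * G i j"]) (simp_all add: G_nonzero quad_far rescale_pscale)
next
  case (quad_adj i j)
  \<comment> \<open>The two summands carry different dots, with scalars D_i and D_j.
    \<open>G_adj\<close> in both orders gives them the same overall factor.\<close>
  have "G j i * G i j * tt P' i j = D i * tt P i j" "G j i * G i j * tt P' j i = D j * tt P j i"
    using G_adj[of i j] G_adj[of j i] quad_adj cdot_sym[of i j] by (simp_all add: mult.commute)
  then show ?thesis
    unfolding quad_adj(1-4)
    by (intro proportionalI[where R = "klr_rel C P'", OF klr_rel.quad_adj[of i j],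
          where c = "G j i * G i j"])
      (simp_all add: G_nonzero quad_adj rescale_pscale rescale_add pscale.scale_right_distrib
        mult.commute)
next
  case (nil_left i)
  show ?thesis
    unfolding nil_left
    by (rule proportionalI[where R = "klr_rel C P'", OF klr_rel.nil_left[of _ _ i], where c = 1])
      (simp_all add: rescale_diff G_same D_nonzero)
next
  case (nil_right i)
  show ?thesis
    unfolding nil_right
    by (rule proportionalI[where R = "klr_rel C P'", OF klr_rel.nil_right[of _ _ i], where c = 1])
      (simp_all add: rescale_diff G_same D_nonzero)
next
  case (slide_left i j)
  show ?thesis
    unfolding slide_left(1-4)
    by (rule proportionalI[where R = "klr_rel C P'", OF klr_rel.slide_left[of i j],
          where c = "G i j * D i"]) (simp_all add: slide_left G_nonzero D_nonzero mult.commute)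
next
  case (slide_right i j)
  show ?thesis
    unfolding slide_right(1-4)
    by (rule proportionalI[where R = "klr_rel C P'", OF klr_rel.slide_right[of i j],
          where c = "G i j * D j"]) (simp_all add: slide_right G_nonzero D_nonzero mult.commute)
next
  case (cubic i j k)
  \<comment> \<open>The right side of the cubic relation is nonzero only for k = i. The extra
    crossing of two i-strands then contributes D_i^-1, which removes the D_i of
    \<open>G_adj\<close>; i = j is impossible because i\<cdot>i = 2.\<close>
  have "G i j * (G i i * G j i) * tt P' i j = tt P i j" if "cdot C i j = -1"
    using G_adj[of i j] that D_nonzero[of i] cdot_same[of i]
    by (cases "i = j") (simp_all add: G_same field_simps)
  then show ?thesis
    unfolding cubic
    by (intro proportionalI[where R = "klr_rel C P'", OF klr_rel.cubic[of _ _ i j k],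
          where c = "G i j * (G i k * G j k)"])
      (auto simp: rescale_diff pscale.scale_right_diff_distrib rescale_pscale G_nonzero mult_ac)
qed

lemma u_rel_rescale:
  assumes "u_rel C P x a b p q"
  shows "\<exists>c p' q'. c \<noteq> 0 \<and> rescale (ds x) p = pscale c p' \<and> rescale (ds x) q = pscale c q' \<and>
    u_rel C P' x a b p' q'"
  using assms
proof cases
  case interchange
  then show ?thesis
  proof cases
    case (1 g m g')
    show ?thesis
      unfolding 1
      by (rule proportionalI[where R = "u_rel C P' x", OF u_rel.interchange[OF interchange.intros[of g m g']],
            where c = "ds x [([], g, m @ gtrg g'), (gsrc g @ m, g', [])]"])
        (simp_all add: gen_scale_nonzero wt_gsrc mult.commute)
  qed
next
  case (adj_E i)
  show ?thesis
    unfolding adj_E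
    by (rule proportionalI[where R = "u_rel C P' x", OF u_rel.adj_E, where c = 1])
      (simp_all add: gen_scale_Eta gen_scale_nonzero)
next
  case (adj_E' i)
  show ?thesis
    unfolding adj_E'
    by (rule proportionalI[where R = "u_rel C P' x", OF u_rel.adj_E', where c = 1]) simp_all
next
  case (adj_F i)
  show ?thesis
    unfolding adj_F
    by (rule proportionalI[where R = "u_rel C P' x", OF u_rel.adj_F, where c = 1])
      (simp_all add: gen_scale_Eta gen_scale_nonzero)
next
  case (adj_F' i)
  show ?thesis
    unfolding adj_F'
    by (rule proportionalI[where R = "u_rel C P' x", OF u_rel.adj_F', where c = 1]) simp_all
next
  case (cyclic_dot i)
  show ?thesis
    unfolding cyclic_dot
    by (rule proportionalI[where R = "u_rel C P' x", OF u_rel.cyclic_dot, where c = "D i"])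
      (simp_all add: gen_scale_Eta gen_scale_nonzero D_nonzero field_simps)
next
  \<comment> \<open>The nested \<open>Eps\<close> and \<open>Eta\<close> on one side leave
    \<open>turn j i / turn i j\<close>, which is 1 by symmetry; the other side involves only
    \<open>Eps'\<close> and \<open>Eta'\<close>. Both keep the scalar of the crossing.\<close>
  case (cyclic_cross i j)
  show ?thesis
    unfolding cyclic_cross
    by (rule proportionalI[where R = "u_rel C P' x", OF u_rel.cyclic_cross, where c = "G i j"])
      (simp_all add: weight_shift gen_scale_nonzero turn_nonzero G_nonzero turn_sym[of j i]
        algebra_simps)
next
  case klr
  then show ?thesis
    using klr_rel_rescale u_rel.klr by metis
next
  case (mixed_FE i j)
  have "G j i / turn j i * G i j = 1"
    using G_mult[of j i] mixed_FE turn_nonzero[of j i] by simp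
  then show ?thesis
    unfolding mixed_FE(1-4)
    by (intro proportionalI[where R = "u_rel C P' x", OF u_rel.mixed_FE, where c = 1])
      (simp_all add: mixed_FE rescale_diagram_vert vert_pscale_left vert_pscale_right
        diagram_scale_sig diagram_scale_sig' mult.commute)
next
  case (mixed_EF i j)
  have "G j i / turn j i * G i j = 1"
    using G_mult[of j i] mixed_EF turn_nonzero[of j i] by simp
  then show ?thesis
    unfolding mixed_EF(1-4)
    by (intro proportionalI[where R = "u_rel C P' x", OF u_rel.mixed_EF, where c = 1])
      (simp_all add: mixed_EF rescale_diagram_vert vert_pscale_left vert_pscale_right
        diagram_scale_sig diagram_scale_sig' mult.commute)
next
  case (cw_zero m i)
  show ?thesis
    unfolding cw_zero(1-4)
    by (rule proportionalI[where R = "u_rel C P' x" and f = "rescale (ds x)",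
          OF u_rel.cw_zero[OF cw_zero(5)] _ rescale_cw[of x i m]])
      (simp_all add: cpl_nonzero D_nonzero)
next
  case (ccw_zero m i)
  show ?thesis
    unfolding ccw_zero(1-4)
    by (rule proportionalI[where R = "u_rel C P' x" and f = "rescale (ds x)",
          OF u_rel.ccw_zero[OF ccw_zero(5)] _ rescale_ccw[of x i m]])
      (simp_all add: cmi_nonzero D_nonzero)
next
  case (cw_one m i)
  show ?thesis
    unfolding cw_one(1-4)
    by (rule proportionalI[where R = "u_rel C P' x" and f = "rescale (ds x)",
          OF u_rel.cw_one[OF cw_one(5)] _ rescale_cw[of x i m]])
      (simp_all add: cw_one(5) cpl_nonzero D_nonzero rescale_pscale)
next
  case (ccw_one m i)
  show ?thesis
    unfolding ccw_one(1-4)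
    by (rule proportionalI[where R = "u_rel C P' x" and f = "rescale (ds x)",
          OF u_rel.ccw_one[OF ccw_one(5)] _ rescale_ccw[of x i m]])
      (simp_all add: ccw_one(5) cmi_nonzero D_nonzero rescale_pscale)
next
  case (sl2_EF i)
  let ?T = "\<lambda>P (f1, f2, f3). vert (dg (replicate f3 ([], Dot i, [F i]) @ [([], Eta' i, [])]))
    (vert (ccws C P x i f2) (dg ([([], Eps i, [])] @ replicate f1 ([], Dot i, [F i]))))"
  have T: "rescale (ds x) (?T P f) = pscale (bub P' i / bub P i) (?T P' f)"
    if "f \<in> {(f1, f2, f3). int (f1 + f2 + f3) = coroot C i x - 1}" for f
  proof -
    obtain f1 f2 f3 where f: "f = (f1, f2, f3)"
      by (cases f)
    with that have "int (f1 + f2 + f3) = coroot C i x - 1"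
      by simp
    \<comment> \<open>The inner bubble of degree 2 f2 counts like f2 dots, so the total power of D_i
      is governed by the constraint on the sum and cancels that of \<open>Eps i\<close>.\<close>
    then have "gs x (Eps i) * D i ^ (f1 + f2 + f3) = cpl P i x / cpl P' i x"
      unfolding gen_scale_Eps_dots by simp
    moreover have "D i ^ f3 * (D i ^ f2 * (cmi P i x / cmi P' i x) * (gs x (Eps i) * D i ^ f1)) =
        gs x (Eps i) * D i ^ (f1 + f2 + f3) * (cmi P i x / cmi P' i x)"
      by (simp only: power_add mult_ac)
    ultimately have "D i ^ f3 * (D i ^ f2 * (cmi P i x / cmi P' i x) * (gs x (Eps i) * D i ^ f1)) =
        bub P' i / bub P i"
      by (simp only: cpl_cmi_ratio)
    then show ?thesis
      by (simp add: f rescale_diagram_vert rescale_ccws vert_pscale_left vert_pscale_right mult_ac)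
  qed
  have S: "rescale (ds x) (sum (?T P) {(f1, f2, f3). int (f1 + f2 + f3) = coroot C i x - 1}) =
      pscale (bub P' i / bub P i)
        (sum (?T P') {(f1, f2, f3). int (f1 + f2 + f3) = coroot C i x - 1})"
    unfolding rescale_sum pscale.scale_sum_right by (rule sum.cong[OF refl T])
  have V: "rescale (ds x) (vert (dg (sig' i i)) (dg (sig i i))) =
      pscale (bub P' i / bub P i) (vert (dg (sig' i i)) (dg (sig i i)))"
    using G_mult_same[of i]
    by (simp add: rescale_diagram_vert vert_pscale_left vert_pscale_right diagram_scale_sig
        diagram_scale_sig' mult.commute)
  have "rescale (ds x) (pscale (bub P i) (vert (dg (sig' i i)) (dg (sig i i)))
        - pscale (bub P i) (sum (?T P) {(f1, f2, f3). int (f1 + f2 + f3) = coroot C i x - 1})) =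
      pscale (bub P' i) (vert (dg (sig' i i)) (dg (sig i i)))
        - pscale (bub P' i) (sum (?T P') {(f1, f2, f3). int (f1 + f2 + f3) = coroot C i x - 1})"
    by (simp only: rescale_diff rescale_pscale S V pscale.scale_scale)
      (simp add: bub_nonzero)
  then show ?thesis
    unfolding sl2_EF
    by (intro proportionalI[where R = "u_rel C P' x", OF u_rel.sl2_EF, where c = 1]) simp_all
next
  case (sl2_FE i)
  let ?T = "\<lambda>P (f1, f2, f3). vert (dg (replicate f3 ([F i], Dot i, []) @ [([], Eta i, [])]))
    (vert (cws C P x i f2) (dg ([([], Eps' i, [])] @ replicate f1 ([F i], Dot i, []))))"
  have T: "rescale (ds x) (?T P f) = pscale (bub P' i / bub P i) (?T P' f)"
    if "f \<in> {(f1, f2, f3). int (f1 + f2 + f3) = - coroot C i x - 1}" for f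
  proof -
    obtain f1 f2 f3 where f: "f = (f1, f2, f3)"
      by (cases f)
    with that have "int (f1 + f2 + f3) = - coroot C i x - 1"
      by simp
    then have "gs x (Eta i) * D i ^ (f1 + f2 + f3) = cmi P i x / cmi P' i x"
      unfolding gen_scale_Eta_dots by simp
    moreover have "D i ^ f3 * gs x (Eta i) * (D i ^ f2 * (cpl P i x / cpl P' i x) * D i ^ f1) =
        cpl P i x / cpl P' i x * (gs x (Eta i) * D i ^ (f1 + f2 + f3))"
      by (simp only: power_add mult_ac)
    ultimately have "D i ^ f3 * gs x (Eta i) * (D i ^ f2 * (cpl P i x / cpl P' i x) * D i ^ f1) =
        bub P' i / bub P i"
      by (simp only: cpl_cmi_ratio)
    then show ?thesis
      by (simp add: f rescale_diagram_vert rescale_cws vert_pscale_left vert_pscale_right mult_ac)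
  qed
  have S: "rescale (ds x) (sum (?T P) {(f1, f2, f3). int (f1 + f2 + f3) = - coroot C i x - 1}) =
      pscale (bub P' i / bub P i)
        (sum (?T P') {(f1, f2, f3). int (f1 + f2 + f3) = - coroot C i x - 1})"
    unfolding rescale_sum pscale.scale_sum_right by (rule sum.cong[OF refl T])
  have V: "rescale (ds x) (vert (dg (sig i i)) (dg (sig' i i))) =
      pscale (bub P' i / bub P i) (vert (dg (sig i i)) (dg (sig' i i)))"
    using G_mult_same[of i]
    by (simp add: rescale_diagram_vert vert_pscale_left vert_pscale_right diagram_scale_sig
        diagram_scale_sig' mult.commute)
  have "rescale (ds x) (pscale (bub P i) (vert (dg (sig i i)) (dg (sig' i i)))
        - pscale (bub P i) (sum (?T P) {(f1, f2, f3). int (f1 + f2 + f3) = - coroot C i x - 1})) =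
      pscale (bub P' i) (vert (dg (sig i i)) (dg (sig' i i)))
        - pscale (bub P' i) (sum (?T P') {(f1, f2, f3). int (f1 + f2 + f3) = - coroot C i x - 1})"
    by (simp only: rescale_diff rescale_pscale S V pscale.scale_scale)
      (simp add: bub_nonzero)
  then show ?thesis
    unfolding sl2_FE
    by (intro proportionalI[where R = "u_rel C P' x", OF u_rel.sl2_FE, where c = 1]) simp_all
qed

lemma hom_combs_rescale [simp]: "rescale (ds x) p \<in> hom_combs C x w w' d \<longleftrightarrow> p \<in> hom_combs C x w w' d"
  by (simp add: hom_combs_def keys_rescale diagram_scale_nonzero)

lemma hom_null_rescale:
  assumes "z \<in> hom_null C P x w w' d"
  shows "rescale (ds x) z \<in> hom_null C P' x w w' d"
  using assms unfolding hom_null_def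
proof (rule span_induct_map)
  fix z
  assume "z \<in> {context_comb s2 l p u s1 - context_comb s2 l q u s1 |s2 l p q u s1 a b.
        u_rel C P (x + wt C u) a b p q \<and>
        typed w s1 (l @ a @ u) \<and> typed (l @ b @ u) s2 w' \<and>
        context_comb s2 l p u s1 \<in> hom_combs C x w w' d \<and>
        context_comb s2 l q u s1 \<in> hom_combs C x w w' d}"
  then obtain s2 l p q u s1 a b where
    z: "z = context_comb s2 l p u s1 - context_comb s2 l q u s1"
    and rel: "u_rel C P (x + wt C u) a b p q"
    and typed: "typed w s1 (l @ a @ u)" "typed (l @ b @ u) s2 w'"
    and hom: "context_comb s2 l p u s1 \<in> hom_combs C x w w' d"
      "context_comb s2 l q u s1 \<in> hom_combs C x w w' d"
    by blast
  obtain c p' q' where c: "c \<noteq> 0" and p': "rescale (ds (x + wt C u)) p = pscale c p'"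
    and q': "rescale (ds (x + wt C u)) q = pscale c q'"
    and rel': "u_rel C P' (x + wt C u) a b p' q'"
    using u_rel_rescale[OF rel] by blast
  \<comment> \<open>That \<open>e\<close> is nonzero matters twice removed from scaling: homogeneity
    of the new relation in context is read off from its multiple by \<open>e\<close>.\<close>
  define e where "e = ds x s2 * ds x s1 * c"
  have "e \<noteq> 0"
    by (simp add: e_def c diagram_scale_nonzero)
  have eq: "rescale (ds x) (context_comb s2 l p u s1) = pscale e (context_comb s2 l p' u s1)"
    "rescale (ds x) (context_comb s2 l q u s1) = pscale e (context_comb s2 l q' u s1)"
    by (simp_all add: rescale_context_comb p' q' context_comb_pscale e_def)
  have "context_comb s2 l p' u s1 \<in> hom_combs C x w w' d"
    "context_comb s2 l q' u s1 \<in> hom_combs C x w w' d"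
    using hom \<open>e \<noteq> 0\<close> eq by (metis hom_combs_rescale hom_combs_pscale)+
  with rel' typed have "context_comb s2 l p' u s1 - context_comb s2 l q' u s1 \<in>
      {context_comb s2 l p u s1 - context_comb s2 l q u s1 |s2 l p q u s1 a b.
        u_rel C P' (x + wt C u) a b p q \<and>
        typed w s1 (l @ a @ u) \<and> typed (l @ b @ u) s2 w' \<and>
        context_comb s2 l p u s1 \<in> hom_combs C x w w' d \<and>
        context_comb s2 l q u s1 \<in> hom_combs C x w w' d}" (is "_ \<in> ?S")
    by blast
  then have "pscale e (context_comb s2 l p' u s1 - context_comb s2 l q' u s1) \<in> pscale.span ?S"
    by (intro pscale.span_scale pscale.span_base)
  then show "rescale (ds x) z \<in> pscale.span ?S"
    by (simp add: z rescale_diff eq pscale.scale_right_diff_distrib)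
qed (simp_all add: rescale_add rescale_pscale pscale.subspace_span)

text \<open>The converse is the forward statement for the instance \<open>rescaling_swap\<close>,
  whose rescaling is the inverse map.\<close>

lemma hom_null_rescale_iff:
  "rescale (ds x) z \<in> hom_null C P' x w w' d \<longleftrightarrow> z \<in> hom_null C P x w w' d"
  using rescaling.hom_null_rescale[OF rescaling_swap, of "rescale (ds x) z" x w w' d]
    hom_null_rescale[of z x w w' d]
  by (auto simp: diagram_scale_swap rescale_inverse(1)[OF diagram_scale_nonzero])

end

section \<open>The isomorphism of 2-categories\<close>

context rescaling
begin

definition rescale_mat :: "'x \<Rightarrow> ('i, 'k) dmat \<Rightarrow> ('i, 'k) dmat" where
  "rescale_mat x M = (\<lambda>a b. rescale (ds x) (M a b))"

text \<open>A 2-morphism contains its whole class of matrices, so taking the image avoids choosing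
  representatives. All entries share the rightmost weight \<open>osrc f\<close>.\<close>

definition rescale_cell :: "('x, 'i, 'k) twocell \<Rightarrow> ('x, 'i, 'k) twocell" where
  "rescale_cell = (\<lambda>(f, g, A). (f, g, rescale_mat (osrc f) ` A))"

lemma rescale_cell_simp [simp]: "rescale_cell (f, g, A) = (f, g, rescale_mat (osrc f) ` A)"
  by (simp add: rescale_cell_def)

lemma rescale_mat_inverse:
  "rescale_mat x (\<lambda>a b. rescale (\<lambda>s. inverse (ds x s)) (M a b)) = M"
  by (simp add: rescale_mat_def rescale_inverse(2)[OF diagram_scale_nonzero])

lemma inj_rescale_mat: "inj (rescale_mat x)"
  by (rule inj_on_inverseI[where g = "\<lambda>M a b. rescale (\<lambda>s. inverse (ds x s)) (M a b)"])
    (simp add: rescale_mat_def rescale_inverse(1)[OF diagram_scale_nonzero])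

lemma rescale_eq_0_iff [simp]: "rescale (ds x) p = 0 \<longleftrightarrow> p = 0"
  by (simp add: keys_rescale diagram_scale_nonzero flip: keys_eq_empty)

lemma rescale_mat_in_dmats [simp]: "rescale_mat (osrc f) M \<in> dmats C f g \<longleftrightarrow> M \<in> dmats C f g"
  by (simp add: dmats_def rescale_mat_def)

text \<open>The image of a class must be an entire class, not just part of one; this uses the
  equivalence \<open>hom_null_rescale_iff\<close> and the surjectivity of
  \<open>rescale_mat\<close>.\<close>

lemma rescale_mat_dclass:
  "rescale_mat (osrc f) ` dclass C P f g M = dclass C P' f g (rescale_mat (osrc f) M)"
proof -
  have iff: "rescale_mat (osrc f) N \<in> dclass C P' f g (rescale_mat (osrc f) M) \<longleftrightarrow>
      N \<in> dclass C P f g M" for N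
    by (simp add: dclass_def)
      (simp add: rescale_mat_def hom_null_rescale_iff flip: rescale_diff)
  show ?thesis
  proof (intro equalityI subsetI)
    fix N
    assume "N \<in> dclass C P' f g (rescale_mat (osrc f) M)"
    then show "N \<in> rescale_mat (osrc f) ` dclass C P f g M"
      by (metis iff image_eqI rescale_mat_inverse)
  qed (use iff in blast)
qed

lemma rescale_mat_unit [simp]: "rescale_mat x (dmat_unit a b n) = dmat_unit a b n"
  by (auto simp: rescale_mat_def dmat_unit_def fun_eq_iff)

lemma rescale_mat_vert:
  "rescale_mat x (dmat_vert n N M) = dmat_vert n (rescale_mat x N) (rescale_mat x M)"
  by (simp add: rescale_mat_def dmat_vert_def rescale_sum rescale_diagram_vert)

lemma osrc_onecells: "f \<in> onecells C x y \<Longrightarrow> osrc f = x"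
  by (auto simp: onecells_def)

lemma onecells_weight: "z \<in> set (summands f) \<Longrightarrow> f \<in> onecells C x y \<Longrightarrow> x + wt C (fst z) = y"
  by (cases f) (auto simp: onecells_def)

text \<open>The region between the two factors has weight \<open>y\<close>, hence the left factor is
  rescaled there. Every summand of \<open>g\<close> leads from \<open>x\<close> to the same
  \<open>y\<close>, so this weight does not vary with the matrix entry.\<close>

lemma rescale_mat_horiz:
  assumes "g \<in> onecells C x y"
  shows "rescale_mat x (dmat_horiz f' g' f g N M) =
    dmat_horiz f' g' f g (rescale_mat y N) (rescale_mat x M)"
proof -
  have "x + wt C (fst (summands g ! (a mod length (summands g)))) = y"
    if "a < length (summands g') * length (summands g)" for a
  proof -
    have "length (summands g) > 0"
      using that by (cases "length (summands g)") auto
    then have "summands g ! (a mod length (summands g)) \<in> set (summands g)"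
      by simp
    then show ?thesis
      using assms by (rule onecells_weight)
  qed
  then show ?thesis
    by (auto simp: rescale_mat_def dmat_horiz_def Let_def fun_eq_iff rescale_horiz)
qed

lemma rescale_cell_in_mor2:
  "m \<in> mor2 (U_cat C P) f g \<Longrightarrow> rescale_cell m \<in> mor2 (U_cat C P') f g"
  using rescale_mat_dclass[of f g] by (auto simp: U_cat_def simp del: split_paired_Ex)

lemma two_functor_rescale_cell: "two_functor (U_cat C P) (U_cat C P') id id rescale_cell"
  unfolding two_functor_def
proof (intro conjI ballI allI)
  fix a b c f g f' g' m m'
  assume f: "f \<in> mor1 (U_cat C P) a b" and g: "g \<in> mor1 (U_cat C P) a b"
    and m: "m \<in> mor2 (U_cat C P) f g"
    and f': "f' \<in> mor1 (U_cat C P) b c" and g': "g' \<in> mor1 (U_cat C P) b c"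
    and m': "m' \<in> mor2 (U_cat C P) f' g'"
  have [simp]: "osrc f = a" "osrc g = a" "osrc f' = b"
    using f g f' by (simp_all add: U_cat_def osrc_onecells)
  obtain A A' where [simp]: "m = (f, g, A)" "m' = (f', g', A')"
    using m m' by (auto simp: U_cat_def)
  have "g \<in> onecells C a b"
    using g by (simp add: U_cat_def)
  then show "rescale_cell (hcomp (U_cat C P) m' m) =
      hcomp (U_cat C P') (rescale_cell m') (rescale_cell m)"
    using rescale_mat_dclass[of "onecell_comp f' f" "onecell_comp g' g"]
    by (simp add: U_cat_def image_UN rescale_mat_horiz onecell_comp_def)
next
  fix a b f g h m m'
  assume f: "f \<in> mor1 (U_cat C P) a b" and g: "g \<in> mor1 (U_cat C P) a b"
    and m: "m \<in> mor2 (U_cat C P) f g" and m': "m' \<in> mor2 (U_cat C P) g h"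
  have [simp]: "osrc f = a" "osrc g = a"
    using f g by (simp_all add: U_cat_def osrc_onecells)
  obtain A A' where [simp]: "m = (f, g, A)" "m' = (g, h, A')"
    using m m' by (auto simp: U_cat_def)
  show "rescale_cell (vcomp (U_cat C P) m' m) =
      vcomp (U_cat C P') (rescale_cell m') (rescale_cell m)"
    using rescale_mat_dclass[of f h] by (simp add: U_cat_def image_UN rescale_mat_vert)
next
  fix a b f g m m'
  assume m: "m \<in> mor2 (U_cat C P) f g" and m': "m' \<in> mor2 (U_cat C P) f g"
  obtain A A' where [simp]: "m = (f, g, A)" "m' = (f, g, A')"
    using m m' by (auto simp: U_cat_def)
  have "rescale_mat (osrc f) (\<lambda>a b. M a b + N a b) =
      (\<lambda>a b. rescale_mat (osrc f) M a b + rescale_mat (osrc f) N a b)" for M N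
    by (simp add: rescale_mat_def rescale_add)
  then show "rescale_cell (plus2 (U_cat C P) m m') =
      plus2 (U_cat C P') (rescale_cell m) (rescale_cell m')"
    by (simp add: U_cat_def image_UN rescale_mat_dclass)
next
  fix a b f g m c
  assume m: "m \<in> mor2 (U_cat C P) f g"
  obtain A where [simp]: "m = (f, g, A)"
    using m by (auto simp: U_cat_def)
  have "rescale_mat (osrc f) (\<lambda>a b. pscale c (M a b)) =
      (\<lambda>a b. pscale c (rescale_mat (osrc f) M a b))" for M
    by (simp add: rescale_mat_def rescale_pscale)
  then show "rescale_cell (scale2 (U_cat C P) c m) = scale2 (U_cat C P') c (rescale_cell m)"
    by (simp add: U_cat_def image_UN rescale_mat_dclass)
next
  fix a b f g m
  assume m: "m \<in> mor2 (U_cat C P) f g"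
  then show "rescale_cell m \<in> mor2 (U_cat C P') (id f) (id g)"
    using rescale_cell_in_mor2 by simp
  show "rescale_cell (shift2 (U_cat C P) n m) = shift2 (U_cat C P') n (rescale_cell m)" for n
    using m by (auto simp: U_cat_def onecell_shift_def)
next
  fix a b f g
  assume "g \<in> mor1 (U_cat C P) a b" "f \<in> mor1 (U_cat C P) a b"
  then have "osrc f = a" "osrc g = a"
    by (simp_all add: U_cat_def osrc_onecells)
  then show "rescale_cell (incl_l (U_cat C P) f g) = incl_l (U_cat C P') (id f) (id g)"
    "rescale_cell (incl_r (U_cat C P) f g) = incl_r (U_cat C P') (id f) (id g)"
    using rescale_mat_dclass[of f] rescale_mat_dclass[of g] by (simp_all add: U_cat_def)
qed (simp_all add: U_cat_def rescale_mat_dclass)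

lemma two_cat_iso_rescale_cell: "two_cat_iso (U_cat C P) (U_cat C P') id id rescale_cell"
  unfolding two_cat_iso_def
proof (intro conjI ballI)
  fix a b f g
  show "bij_betw rescale_cell (mor2 (U_cat C P) f g) (mor2 (U_cat C P') (id f) (id g))"
  proof (rule bij_betw_imageI)
    show "inj_on rescale_cell (mor2 (U_cat C P) f g)"
      using inj_image_eq_iff[OF inj_rescale_mat] by (auto simp: U_cat_def inj_on_def)
    show "rescale_cell ` mor2 (U_cat C P) f g = mor2 (U_cat C P') (id f) (id g)"
    proof (intro equalityI subsetI)
      fix m
      assume "m \<in> mor2 (U_cat C P') (id f) (id g)"
      then obtain M where "M \<in> dmats C f g" and m: "m = (f, g, dclass C P' f g M)"
        by (auto simp: U_cat_def)
      moreover obtain N where "M = rescale_mat (osrc f) N"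
        by (metis rescale_mat_inverse)
      ultimately have "(f, g, dclass C P f g N) \<in> mor2 (U_cat C P) f g"
        and "m = rescale_cell (f, g, dclass C P f g N)"
        by (auto simp: U_cat_def rescale_mat_dclass)
      then show "m \<in> rescale_cell ` mor2 (U_cat C P) f g"
        by (rule rev_image_eqI)
    qed (auto simp del: rescale_cell_simp split_paired_All intro: rescale_cell_in_mor2)
  qed
qed (simp_all add: two_functor_rescale_cell, simp_all add: U_cat_def bij_betw_def)

lemma rescale_cell_cell:
  "rescale_cell (cell C P x w w' d p) = cell C P' x w w' d (rescale (ds x) p)"
proof -
  have "rescale_mat x (\<lambda>a b. if a = 0 \<and> b = 0 then p else 0) =
      (\<lambda>a b. if a = 0 \<and> b = 0 then rescale (ds x) p else 0)"
    by (auto simp: rescale_mat_def fun_eq_iff)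
  then show ?thesis
    using rescale_mat_dclass[of "(x, x + wt C w, [(w, 0)])"]
    by (simp add: cell_def Let_def)
qed

end

lemma hom_null_zero: "0 \<in> hom_null C P x w w' d"
  and hom_null_add: "p \<in> hom_null C P x w w' d \<Longrightarrow> q \<in> hom_null C P x w w' d \<Longrightarrow>
    p + q \<in> hom_null C P x w w' d"
  and hom_null_diff: "p \<in> hom_null C P x w w' d \<Longrightarrow> q \<in> hom_null C P x w w' d \<Longrightarrow>
    p - q \<in> hom_null C P x w w' d"
  and hom_null_pscale: "p \<in> hom_null C P x w w' d \<Longrightarrow> pscale c p \<in> hom_null C P x w w' d"
  unfolding hom_null_def
  by (fact pscale.span_zero pscale.span_add pscale.span_diff pscale.span_scale)+

lemma dclass_eqI:
  assumes "\<And>a b. a < length (summands g) \<Longrightarrow> b < length (summands f) \<Longrightarrow>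
    N a b - M a b \<in> hom_null C P (osrc f) (fst (summands f ! b)) (fst (summands g ! a))
      (snd (summands g ! a) - snd (summands f ! b))"
  shows "dclass C P f g N = dclass C P f g M"
proof -
  have "p - N a b \<in> hom_null C P (osrc f) (fst (summands f ! b)) (fst (summands g ! a))
        (snd (summands g ! a) - snd (summands f ! b)) \<longleftrightarrow>
      p - M a b \<in> hom_null C P (osrc f) (fst (summands f ! b)) (fst (summands g ! a))
        (snd (summands g ! a) - snd (summands f ! b))"
    if "a < length (summands g)" "b < length (summands f)" for p a b
    using hom_null_add[OF _ assms[OF that], of "p - N a b"]
      hom_null_diff[OF _ assms[OF that], of "p - M a b"] by auto
  then show ?thesis
    by (auto simp: dclass_def)
qed

lemma cell_eqI:
  assumes "p - q \<in> hom_null C P x w w' d"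
  shows "cell C P x w w' d p = cell C P x w w' d q"
  unfolding cell_def Let_def using assms by (auto intro!: dclass_eqI)

lemma scale2_gen_cell:
  fixes C :: "('x::ab_group_add, 'i, 'q) cartan" and P :: "('x, 'i, 'k::field) params"
  shows
  "scale2 (U_cat C P) c (gen_cell C P x g) =
    cell C P x (gsrc g) (gtrg g) (gdeg C x g) (pscale c (dg [([], g, [])]))"
proof -
  let ?f = "(x, x + wt C (gsrc g), [(gsrc g, 0)])" and ?g = "(x, x + wt C (gtrg g), [(gtrg g, gdeg C x g)])"
  let ?M = "\<lambda>a b. if a = 0 \<and> b = 0 then dg [([], g, [])] else 0 :: ('i, 'k) lincomb"
  \<comment> \<open>The class is nonempty, so the union in \<open>scale2\<close>, whose members are
    all equal by the next fact, collapses to one class.\<close>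
  have "?M \<in> dclass C P ?f ?g ?M"
    by (auto simp: dclass_def dmats_def hom_combs_def dg_def ddeg_def hom_null_zero)
  moreover have "dclass C P ?f ?g (\<lambda>a b. pscale c (N a b)) =
      dclass C P ?f ?g (\<lambda>a b. if a = 0 \<and> b = 0 then pscale c (dg [([], g, [])]) else 0)"
    if "N \<in> dclass C P ?f ?g ?M" for N
    using that
    by (intro dclass_eqI) (auto simp: dclass_def hom_null_pscale simp flip: pscale.scale_right_diff_distrib)
  ultimately show ?thesis
    by (auto simp: U_cat_def gen_cell_def cell_def Let_def)
qed

context rescaling
begin

lemma rescale_cell_gen_cell:
  "rescale_cell (gen_cell C P x g) = scale2 (U_cat C P') (gs x g) (gen_cell C P' x g)"
  unfolding scale2_gen_cell by (simp add: gen_cell_def rescale_cell_cell)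

end

section \<open>KLR algebras\<close>

lemma typed_append: "typed w (t @ s) w'' \<longleftrightarrow> (\<exists>w'. typed w s w' \<and> typed w' t w'')"
  by (induction t arbitrary: w'') auto

lemma typed_unique: "typed w s w' \<Longrightarrow> typed w s w'' \<Longrightarrow> w' = w''"
  by (cases s) auto

lemma typed_whisk_diagram:
  "typed w s w' \<Longrightarrow> typed (l @ w @ u) (whisk_diagram l s u) (l @ w' @ u)"
  by (induction w s w' rule: typed.induct) (auto simp: whisk_diagram_def)

lemma ddeg_Nil [simp]: "ddeg C x [] = 0"
  and ddeg_Cons [simp]: "ddeg C x ((l, g, u) # s) = gdeg C (x + wt C u) g + ddeg C x s"
  and ddeg_append [simp]: "ddeg C x (t @ s) = ddeg C x t + ddeg C x s"
  by (simp_all add: ddeg_def)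

lemma ddeg_whisk_diagram: "ddeg C x (whisk_diagram l s u) = ddeg C (x + wt C u) s"
  by (induction s) (auto simp: whisk_diagram_def add_ac)

lemma keys_lin_ext_subset: "Poly_Mapping.keys (lin_ext f p) \<subseteq> f ` Poly_Mapping.keys p"
proof -
  have "Poly_Mapping.keys (lin_ext f p) \<subseteq>
      (\<Union>a\<in>Poly_Mapping.keys p. Poly_Mapping.keys (Poly_Mapping.single (f a) (Poly_Mapping.lookup p a)))"
    unfolding lin_ext_def by (rule keys_sum)
  then show ?thesis
    by (auto split: if_splits)
qed

lemma context_comb_eq_lin_ext:
  "context_comb s2 l p u s1 = lin_ext (\<lambda>s. s2 @ whisk_diagram l s u @ s1) p"
  by (rule additive_eqI_keys[of "\<lambda>p. context_comb s2 l p u s1"])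
    (simp_all add: context_comb_add lin_ext_add, simp add: context_comb_def whisk_def dg_def)

lemma hom_combs_zero: "0 \<in> hom_combs C x w w' d"
  and hom_combs_add: "p \<in> hom_combs C x w w' d \<Longrightarrow> q \<in> hom_combs C x w w' d \<Longrightarrow> p + q \<in> hom_combs C x w w' d"
  and hom_combs_diff: "p \<in> hom_combs C x w w' d \<Longrightarrow> q \<in> hom_combs C x w w' d \<Longrightarrow> p - q \<in> hom_combs C x w w' d"
  using keys_add[of p q] keys_diff[of p q] by (auto simp: hom_combs_def)

lemma hom_combs_pscaleI: "p \<in> hom_combs C x w w' d \<Longrightarrow> pscale c p \<in> hom_combs C x w w' d"
  by (cases "c = 0") (simp_all add: hom_combs_zero hom_combs_pscale)

lemma dg_in_hom_combs: "dg s \<in> hom_combs C x w w' d \<longleftrightarrow> typed w s w' \<and> ddeg C x s = d"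
  by (simp add: hom_combs_def dg_def)

lemma context_comb_in_hom_combs:
  assumes "p \<in> hom_combs C (x + wt C u) a b e" "typed w s1 (l @ a @ u)" "typed (l @ b @ u) s2 w'"
  shows "context_comb s2 l p u s1 \<in> hom_combs C x w w' (ddeg C x s2 + e + ddeg C x s1)"
proof -
  have "typed w (s2 @ whisk_diagram l s u @ s1) w' \<and>
      ddeg C x (s2 @ whisk_diagram l s u @ s1) = ddeg C x s2 + e + ddeg C x s1"
    if "s \<in> Poly_Mapping.keys p" for s
  proof -
    have "typed a s b" "ddeg C (x + wt C u) s = e"
      using assms(1) that by (auto simp: hom_combs_def)
    then show ?thesis
      using assms(2,3) typed_whisk_diagram[of a s b l u] by (auto simp: typed_append ddeg_whisk_diagram)
  qed
  then show ?thesis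
    using keys_lin_ext_subset[of "\<lambda>s. s2 @ whisk_diagram l s u @ s1" p]
    by (fastforce simp: hom_combs_def context_comb_eq_lin_ext)
qed

text \<open>Degrees of dots and crossings do not depend on the weight, so the KLR cases rest on the
  symmetry of \<open>cdot\<close> and i\<cdot>i = 2. The interchange law also admits cups and caps;
  their degrees agree because source and target of a generator have equal weight.\<close>

lemma (in cartan_datum) klr_rel_homogeneous:
  assumes "klr_rel C P a b p q \<or> interchange a b p q"
  obtains e where "p \<in> hom_combs C x a b e" "q \<in> hom_combs C x a b e"
proof -
  have "\<exists>e. p \<in> hom_combs C x a b e \<and> q \<in> hom_combs C x a b e"
    using assms
  proof
    assume "klr_rel C P a b p q"
    then show ?thesis
    proof cases
      case (quad_same i)
      show ?thesis
        unfolding quad_same by (rule exI[of _ "-4"]) (simp add: dg_in_hom_combs hom_combs_zero cdot_same)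
    next
      case (quad_far i j)
      then show ?thesis
        unfolding quad_far(1-4)
        by (intro exI[of _ 0]) (simp add: dg_in_hom_combs hom_combs_pscaleI cdot_sym[of j i])
    next
      case (quad_adj i j)
      then show ?thesis
        unfolding quad_adj(1-4)
        by (intro exI[of _ 2])
          (simp add: dg_in_hom_combs hom_combs_pscaleI hom_combs_add cdot_sym[of j i])
    next
      case (nil_left i)
      show ?thesis
        unfolding nil_left
        by (rule exI[of _ 0]) (simp add: dg_in_hom_combs hom_combs_diff cdot_same)
    next
      case (nil_right i)
      show ?thesis
        unfolding nil_right
        by (rule exI[of _ 0]) (simp add: dg_in_hom_combs hom_combs_diff cdot_same)
    next
      case (slide_left i j)
      show ?thesis
        unfolding slide_left(1-4) by (rule exI[of _ "2 - cdot C i j"]) (simp add: dg_in_hom_combs)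
    next
      case (slide_right i j)
      show ?thesis
        unfolding slide_right(1-4) by (rule exI[of _ "2 - cdot C i j"]) (simp add: dg_in_hom_combs)
    next
      \<comment> \<open>When the right side is nonzero, k = i and i\<cdot>j = -1, so the degree is 1
        - 2 + 1 = 0, that of an identity.\<close>
      case (cubic i j k)
      show ?thesis
        unfolding cubic
        by (rule exI[of _ "- cdot C i j - cdot C i k - cdot C j k"])
          (auto simp: dg_in_hom_combs hom_combs_diff hom_combs_pscaleI hom_combs_zero cdot_same
            cdot_sym[of j])
    qed
  next
    assume "interchange a b p q"
    then show ?thesis
      by cases (auto simp: dg_in_hom_combs wt_gsrc add_ac)
  qed
  with that show ?thesis
    by blast
qed

lemma lookup_at_bottom:
  "Poly_Mapping.lookup (at_bottom is p) (js, s) = (if js = is then Poly_Mapping.lookup p s else 0)"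
  by (simp add: at_bottom_def lin_ext_def lookup_sum lookup_single when_def in_keys_iff)

lemma keys_at_bottom: "Poly_Mapping.keys (at_bottom is p) = Pair is ` Poly_Mapping.keys p"
  by (auto simp: in_keys_iff lookup_at_bottom split: if_splits)

lemma at_bottom_add: "at_bottom is (p + q) = at_bottom is p + at_bottom is q"
  and at_bottom_diff: "at_bottom is (p - q) = at_bottom is p - at_bottom is q"
  and at_bottom_zero [simp]: "at_bottom is 0 = 0"
  and at_bottom_single [simp]: "at_bottom is (Poly_Mapping.single s c) = Poly_Mapping.single (is, s) c"
  by (simp_all add: at_bottom_def lin_ext_add lin_ext_diff lin_ext_pscale)

lemma at_bottom_in_klr_combs:
  "at_bottom is p \<in> klr_combs \<longleftrightarrow> (\<forall>s\<in>Poly_Mapping.keys p. \<exists>js. s \<in> klr_diagrams is js)"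
  by (auto simp: klr_combs_def keys_at_bottom)

lemma up_simps [simp]: "up [] = []" "up (i # is) = E i # up is" "up (is @ js) = up is @ up js"
  by (simp_all add: up_def)

lemma up_inject [simp]: "up is = up js \<longleftrightarrow> is = js"
  unfolding up_def by (rule inj_map_eq_map) (simp add: inj_def)

lemma klr_diagrams_unique: "s \<in> klr_diagrams is js \<Longrightarrow> s \<in> klr_diagrams is js' \<Longrightarrow> js = js'"
  using typed_unique by (fastforce simp: klr_diagrams_def)

lemma klr_diagrams_append:
  "s \<in> klr_diagrams is js \<Longrightarrow> t \<in> klr_diagrams js ks \<Longrightarrow> t @ s \<in> klr_diagrams is ks"
  by (auto simp: klr_diagrams_def typed_append)

section \<open>Products of KLR combinations and the two-sided KLR ideal\<close>

lemma klr_mult_add_left: "klr_mult (q + q') p = klr_mult q p + klr_mult q' p"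
  unfolding klr_mult_def split_beta prod.collapse
  by (rule sum_keys_add)
    (auto simp: single_add algebra_simps sum.distrib[symmetric] intro!: sum.cong sum.neutral)

lemma klr_mult_add_right: "klr_mult q (p + p') = klr_mult q p + klr_mult q p'"
  unfolding klr_mult_def split_beta prod.collapse sum.distrib[symmetric]
  by (intro sum.cong refl sum_keys_add) (simp_all add: single_add algebra_simps)

lemma klr_mult_single:
  "klr_mult (Poly_Mapping.single (js, t) b) (Poly_Mapping.single (is, s) c) =
    (if s \<in> klr_diagrams is js then Poly_Mapping.single (is, t @ s) (b * c) else 0)"
  unfolding klr_mult_def split_beta prod.collapse
  by (subst sum_keys_single, simp) (subst sum_keys_single, simp_all)

lemmas klr_mult_diff_left = additive_diff[of "\<lambda>q. klr_mult q p" for p, OF klr_mult_add_left]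
lemmas klr_mult_diff_right = additive_diff[of "klr_mult q" for q, OF klr_mult_add_right]

lemma klr_mult_pscale_left: "klr_mult (pscale c q) p = pscale c (klr_mult q p)"
  by (rule additive_eqI_keys[of "\<lambda>q. klr_mult (pscale c q) p"],
      simp_all add: klr_mult_add_left pscale.scale_right_distrib)
    (rule additive_eqI_keys[of "klr_mult _"],
      auto simp: klr_mult_add_right pscale.scale_right_distrib klr_mult_single mult.assoc)

lemma klr_mult_pscale_right: "klr_mult q (pscale c p) = pscale c (klr_mult q p)"
  by (rule additive_eqI_keys[of "\<lambda>q. klr_mult q (pscale c p)"],
      simp_all add: klr_mult_add_left pscale.scale_right_distrib)
    (rule additive_eqI_keys[of "\<lambda>p. klr_mult _ (pscale c p)"],
      auto simp: klr_mult_add_right pscale.scale_right_distrib klr_mult_single mult.left_commute)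

text \<open>\<open>klr_mult\<close> tests composability term by term. When all terms of
  \<open>p\<close> share the top \<open>js\<close>, the test has one outcome and the product is a
  vertical composite or zero as a whole.\<close>

lemma klr_mult_single_at_bottom:
  assumes "\<And>s. s \<in> Poly_Mapping.keys p \<Longrightarrow> s \<in> klr_diagrams is js"
  shows "klr_mult (Poly_Mapping.single (js', t) b) (at_bottom is p) =
    (if js' = js then pscale b (at_bottom is (vert (dg t) p)) else 0)"
proof -
  have "klr_mult (Poly_Mapping.single (js', t) b) (at_bottom is p) =
      pscale (if js' = js then b else 0) (at_bottom is (vert (dg t) p))"
    by (rule additive_eqI_keys[of "\<lambda>p. klr_mult (Poly_Mapping.single (js', t) b) (at_bottom is p)"])
      (use assms in \<open>auto simp: klr_mult_add_right at_bottom_add vert_add_right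
        pscale.scale_right_distrib klr_mult_single dg_def dest!: klr_diagrams_unique[OF assms]\<close>)
  then show ?thesis
    by simp
qed

lemma klr_mult_at_bottom_single:
  "klr_mult (at_bottom is p) (Poly_Mapping.single (is', s) b) =
    (if s \<in> klr_diagrams is' is then pscale b (at_bottom is' (vert p (dg s))) else 0)"
proof -
  have "klr_mult (at_bottom is p) (Poly_Mapping.single (is', s) b) =
      pscale (if s \<in> klr_diagrams is' is then b else 0) (at_bottom is' (vert p (dg s)))"
    by (rule additive_eqI_keys[of "\<lambda>p. klr_mult (at_bottom is p) (Poly_Mapping.single (is', s) b)"])
      (auto simp: klr_mult_add_left at_bottom_add vert_add_left
        pscale.scale_right_distrib klr_mult_single dg_def mult.commute)
  then show ?thesis
    by simp
qed

lemma vert_assoc: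
  fixes p q r :: "('i, 'k::field) lincomb"
  shows "vert (vert r q) p = vert r (vert q p)"
proof -
  have 1: "vert (vert (Poly_Mapping.single t b) (Poly_Mapping.single s c)) p =
      vert (Poly_Mapping.single t b) (vert (Poly_Mapping.single s c) p)"
    for t s :: "'i diagram" and b c :: 'k and p
    by (rule additive_eqI_keys[of "vert (vert (Poly_Mapping.single t b) (Poly_Mapping.single s c))"])
      (simp_all add: vert_add_right mult.assoc del: vert_single, simp add: mult.assoc)
  have 2: "vert (vert (Poly_Mapping.single t b) q) p = vert (Poly_Mapping.single t b) (vert q p)"
    for t :: "'i diagram" and b :: 'k and q p
    by (rule additive_eqI_keys[of "\<lambda>q. vert (vert (Poly_Mapping.single t b) q) p"])
      (simp_all add: 1 vert_add_left vert_add_right del: vert_single)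
  show ?thesis
    by (rule additive_eqI_keys[of "\<lambda>r. vert (vert r q) p"]) (simp_all add: 2 vert_add_left)
qed

lemma vert_dg_context_comb: "vert (dg t) (context_comb s2 l p u s1) = context_comb (t @ s2) l p u s1"
  and vert_context_comb_dg: "vert (context_comb s2 l p u s1) (dg t) = context_comb s2 l p u (s1 @ t)"
  by (simp_all add: context_comb_def dg_def vert_assoc flip: vert_assoc[of "Poly_Mapping.single t 1"])

lemma klr_ideal_base:
  assumes "klr_rel C P a b p q \<or> interchange a b p q"
    and "typed (up is) s1 (l @ a @ u)" "typed (l @ b @ u) s2 (up js)"
    and "at_bottom is (context_comb s2 l p u s1) \<in> klr_combs"
    and "at_bottom is (context_comb s2 l q u s1) \<in> klr_combs"
  shows "at_bottom is (context_comb s2 l p u s1 - context_comb s2 l q u s1) \<in> klr_ideal C P"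
  unfolding klr_ideal_def by (rule pscale.span_base) (use assms in blast)

lemma klr_ideal_map:
  fixes f :: "(('i list \<times> 'i diagram) \<Rightarrow>\<^sub>0 'k::field) \<Rightarrow> ('c \<Rightarrow>\<^sub>0 'k)"
  assumes "z \<in> klr_ideal C P"
    and "\<And>p q. f (p + q) = f p + f q" "\<And>c p. f (pscale c p) = pscale c (f p)"
    and "\<And>is js s2 l p q u s1 a b. klr_rel C P a b p q \<or> interchange a b p q \<Longrightarrow>
      typed (up is) s1 (l @ a @ u) \<Longrightarrow> typed (l @ b @ u) s2 (up js) \<Longrightarrow>
      at_bottom is (context_comb s2 l p u s1) \<in> klr_combs \<Longrightarrow>
      at_bottom is (context_comb s2 l q u s1) \<in> klr_combs \<Longrightarrow>
      f (at_bottom is (context_comb s2 l p u s1 - context_comb s2 l q u s1)) \<in> V"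
    and "module.subspace pscale V"
  shows "f z \<in> V"
  using assms(1) unfolding klr_ideal_def
  by (rule span_induct_map) (use assms(2-) in blast)+

lemma subspace_klr_ideal: "module.subspace pscale (klr_ideal C P)"
  unfolding klr_ideal_def by (rule pscale.subspace_span)

lemma klr_ideal_zero: "0 \<in> klr_ideal C P"
  and klr_ideal_add: "p \<in> klr_ideal C P \<Longrightarrow> q \<in> klr_ideal C P \<Longrightarrow> p + q \<in> klr_ideal C P"
  and klr_ideal_diff: "p \<in> klr_ideal C P \<Longrightarrow> q \<in> klr_ideal C P \<Longrightarrow> p - q \<in> klr_ideal C P"
  and klr_ideal_pscale: "p \<in> klr_ideal C P \<Longrightarrow> pscale c p \<in> klr_ideal C P"
  and klr_ideal_sum: "(\<And>a. a \<in> A \<Longrightarrow> g a \<in> klr_ideal C P) \<Longrightarrow> sum g A \<in> klr_ideal C P"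
  unfolding klr_ideal_def
  by (fact pscale.span_zero pscale.span_add pscale.span_diff pscale.span_scale pscale.span_sum)+

lemma (in cartan_datum) klr_relation_context:
  assumes rel: "klr_rel C P a b p q \<or> interchange a b p q"
    and typed: "typed (up is) s1 (l @ a @ u)" "typed (l @ b @ u) s2 (up js)"
  obtains d where "context_comb s2 l p u s1 \<in> hom_combs C x (up is) (up js) d"
    "context_comb s2 l q u s1 \<in> hom_combs C x (up is) (up js) d"
  using klr_rel_homogeneous[OF rel, of "x + wt C u"] context_comb_in_hom_combs[OF _ typed]
  by metis

lemma klr_combs_keys:
  assumes "p \<in> hom_combs C x (up is) (up js) d" "at_bottom is p \<in> klr_combs"
    and "s \<in> Poly_Mapping.keys p"
  shows "s \<in> klr_diagrams is js"
  using assms unfolding at_bottom_in_klr_combs by (fastforce simp: hom_combs_def klr_diagrams_def)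

lemma in_klr_combsI:
  "(\<And>s. s \<in> Poly_Mapping.keys p \<Longrightarrow> s \<in> klr_diagrams is js) \<Longrightarrow> at_bottom is p \<in> klr_combs"
  unfolding at_bottom_in_klr_combs by blast

lemma keys_vert_subset:
  "Poly_Mapping.keys (vert q p) \<subseteq>
    {t @ s |t s. t \<in> Poly_Mapping.keys q \<and> s \<in> Poly_Mapping.keys p}"
proof
  fix r
  assume "r \<in> Poly_Mapping.keys (vert q p)"
  then obtain t where t: "t \<in> Poly_Mapping.keys q" and "r \<in> Poly_Mapping.keys (\<Sum>s\<in>Poly_Mapping.keys p.
      Poly_Mapping.single (t @ s) (Poly_Mapping.lookup q t * Poly_Mapping.lookup p s))"
    unfolding vert_def using keys_sum by fast
  then obtain s where "s \<in> Poly_Mapping.keys p" "r \<in> Poly_Mapping.keys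
      (Poly_Mapping.single (t @ s) (Poly_Mapping.lookup q t * Poly_Mapping.lookup p s))"
    using keys_sum by fast
  with t show "r \<in> {t @ s |t s. t \<in> Poly_Mapping.keys q \<and> s \<in> Poly_Mapping.keys p}"
    by (auto split: if_splits)
qed

text \<open>A composable \<open>t\<close> is absorbed into the upper part of the context of a
  relation, giving a generator again; otherwise both terms of the generator are killed together, as
  they have the same top.\<close>

lemma (in cartan_datum) klr_mult_single_ideal:
  assumes t: "t \<in> klr_diagrams js' ks" and z: "z \<in> klr_ideal C P"
  shows "klr_mult (Poly_Mapping.single (js', t) c) z \<in> klr_ideal C P"
proof -
  show ?thesis
    using z
  proof (rule klr_ideal_map)
    fix "is" js s2 l p q u s1 a b
    assume gen: "klr_rel C P a b p q \<or> interchange a b p q"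
      "typed (up is) s1 (l @ a @ u)" "typed (l @ b @ u) s2 (up js)"
      and combs: "at_bottom is (context_comb s2 l p u s1) \<in> klr_combs"
      "at_bottom is (context_comb s2 l q u s1) \<in> klr_combs"
    \<comment> \<open>Only the common bottom and top are extracted from this, so weight 0 is as good
      as any.\<close>
    obtain d where d: "context_comb s2 l p u s1 \<in> hom_combs C 0 (up is) (up js) d"
      "context_comb s2 l q u s1 \<in> hom_combs C 0 (up is) (up js) d"
      using klr_relation_context[OF gen] .
    note diagrams = klr_combs_keys[OF d(1) combs(1)] klr_combs_keys[OF d(2) combs(2)]
    note mult_eq = klr_mult_single_at_bottom[OF diagrams(1)] klr_mult_single_at_bottom[OF diagrams(2)]
    show "klr_mult (Poly_Mapping.single (js', t) c)
        (at_bottom is (context_comb s2 l p u s1 - context_comb s2 l q u s1)) \<in> klr_ideal C P"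
    proof (cases "js' = js")
      case True
      have "at_bottom is (context_comb (t @ s2) l r u s1) \<in> klr_combs"
        if "\<And>s. s \<in> Poly_Mapping.keys (context_comb s2 l r u s1) \<Longrightarrow> s \<in> klr_diagrams is js" for r
        unfolding vert_dg_context_comb[symmetric]
        by (rule in_klr_combsI[of _ _ ks])
          (use that keys_vert_subset t True klr_diagrams_append in \<open>fastforce simp: dg_def\<close>)
      then have "at_bottom is (context_comb (t @ s2) l p u s1 - context_comb (t @ s2) l q u s1) \<in> klr_ideal C P"
        using gen t True diagrams
        by (intro klr_ideal_base[where js = ks]) (auto simp: typed_append klr_diagrams_def)
      then show ?thesis
        using diagrams True
        by (simp add: at_bottom_diff klr_mult_diff_right mult_eq klr_ideal_pscale
            vert_dg_context_comb flip: pscale.scale_right_diff_distrib)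
    next
      case False
      then show ?thesis
        using diagrams
        by (simp add: at_bottom_diff klr_mult_diff_right mult_eq klr_ideal_zero)
    qed
  qed (simp_all add: klr_mult_add_right klr_mult_pscale_right subspace_klr_ideal)
qed

lemma klr_mult_ideal_single:
  fixes c :: "'k::field" and z :: "('b list \<times> 'b diagram) \<Rightarrow>\<^sub>0 'k"
  assumes z: "z \<in> klr_ideal C P" and s: "s \<in> klr_diagrams is' js'"
  shows "klr_mult z (Poly_Mapping.single (is', s) c) \<in> klr_ideal C P"
  using z
proof (rule klr_ideal_map)
  fix "is" js s2 l u s1 a b and p q :: "('b, 'k) lincomb"
  assume gen: "klr_rel C P a b p q \<or> interchange a b p q"
    "typed (up is) s1 (l @ a @ u)" "typed (l @ b @ u) s2 (up js)"
    and combs: "at_bottom is (context_comb s2 l p u s1) \<in> klr_combs"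
    "at_bottom is (context_comb s2 l q u s1) \<in> klr_combs"
  show "klr_mult (at_bottom is (context_comb s2 l p u s1 - context_comb s2 l q u s1))
      (Poly_Mapping.single (is', s) c) \<in> klr_ideal C P"
  proof (cases "s \<in> klr_diagrams is' is")
    case True
    have "at_bottom is' (context_comb s2 l r u (s1 @ s)) \<in> klr_combs"
      if "at_bottom is (context_comb s2 l r u s1) \<in> klr_combs" for r :: "('b, 'k) lincomb"
      unfolding vert_context_comb_dg[symmetric]
      using that keys_vert_subset[of "context_comb s2 l r u s1" "dg s"] True klr_diagrams_append
      by (fastforce simp: dg_def at_bottom_in_klr_combs)
    then have "at_bottom is' (context_comb s2 l p u (s1 @ s) - context_comb s2 l q u (s1 @ s))
        \<in> klr_ideal C P"
      using gen True combs
      by (intro klr_ideal_base[where js = js]) (auto simp: typed_append klr_diagrams_def)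
    then show ?thesis
      using True
      by (simp add: at_bottom_diff klr_mult_diff_left klr_mult_at_bottom_single klr_ideal_pscale
          vert_context_comb_dg flip: pscale.scale_right_diff_distrib)
  next
    case False
    then show ?thesis
      by (simp add: at_bottom_diff klr_mult_diff_left klr_mult_at_bottom_single klr_ideal_zero)
  qed
qed (simp_all add: klr_mult_add_left klr_mult_pscale_left subspace_klr_ideal)

lemma (in cartan_datum) klr_mult_left_ideal:
  assumes "a \<in> klr_combs" "z \<in> klr_ideal C P"
  shows "klr_mult a z \<in> klr_ideal C P"
proof -
  have "(\<Sum>k\<in>Poly_Mapping.keys a. klr_mult (Poly_Mapping.single k (Poly_Mapping.lookup a k)) z)
      \<in> klr_ideal C P"
    using assms klr_mult_single_ideal by (intro klr_ideal_sum) (fastforce simp: klr_combs_def)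
  then show ?thesis
    by (simp flip: poly_mapping_eq_sum_single
        add: additive_sum[of "\<lambda>a. klr_mult a z", OF klr_mult_add_left, symmetric])
qed

lemma klr_mult_right_ideal:
  assumes "a \<in> klr_combs" "z \<in> klr_ideal C P"
  shows "klr_mult z a \<in> klr_ideal C P"
proof -
  have "(\<Sum>k\<in>Poly_Mapping.keys a. klr_mult z (Poly_Mapping.single k (Poly_Mapping.lookup a k)))
      \<in> klr_ideal C P"
    using assms klr_mult_ideal_single by (intro klr_ideal_sum) (fastforce simp: klr_combs_def)
  then show ?thesis
    by (simp flip: poly_mapping_eq_sum_single
        add: additive_sum[of "klr_mult z", OF klr_mult_add_right, symmetric])
qed

section \<open>Operations on classes, and the KLR isomorphism on arbitrary classes\<close>

lemma klr_class_eqI: "q - p \<in> klr_ideal C P \<Longrightarrow> klr_class C P q = klr_class C P p"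
  using klr_ideal_add[of "_ - q" C P "q - p"] klr_ideal_diff[of "_ - p" C P "q - p"]
  by (force simp: klr_class_def)

lemma klr_class_eqD:
  assumes "klr_class C P q = klr_class C P p" "q \<in> klr_combs"
  shows "q - p \<in> klr_ideal C P"
proof -
  have "q \<in> klr_class C P q"
    using assms(2) by (simp add: klr_class_def klr_ideal_zero)
  then show ?thesis
    unfolding assms(1) by (simp add: klr_class_def)
qed

lemma klr_class_self: "p \<in> klr_combs \<Longrightarrow> p \<in> klr_class C P p"
  by (simp add: klr_class_def klr_ideal_zero)

text \<open>The operations of the quotient are unions over representatives. Well-definedness says
  that the united classes coincide, and membership of \<open>p\<close> in its own class makes the
  union nonempty.\<close>

lemma ascale_klr_class:
  assumes "p \<in> klr_combs"
  shows "ascale (klr_algebra C P) c (klr_class C P p) = klr_class C P (pscale c p)"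
proof -
  have "klr_class C P (pscale c q) = klr_class C P (pscale c p)" if "q \<in> klr_class C P p" for q
    using that klr_ideal_pscale[of "q - p" C P c]
    by (intro klr_class_eqI) (simp add: klr_class_def pscale.scale_right_diff_distrib)
  then show ?thesis
    using klr_class_self[OF assms, of C P]
    unfolding klr_algebra_def lin_algebra.simps by (intro SUP_eq_const) blast+
qed

lemma aplus_klr_class:
  assumes "p \<in> klr_combs" "q \<in> klr_combs"
  shows "aplus (klr_algebra C P) (klr_class C P p) (klr_class C P q) = klr_class C P (p + q)"
proof -
  have "klr_class C P (p' + q') = klr_class C P (p + q)"
    if "p' \<in> klr_class C P p" "q' \<in> klr_class C P q" for p' q'
    using that klr_ideal_add[of "p' - p" C P "q' - q"]
    by (intro klr_class_eqI) (simp add: klr_class_def algebra_simps)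
  then show ?thesis
    using klr_class_self[OF assms(1), of C P] klr_class_self[OF assms(2), of C P]
    unfolding klr_algebra_def lin_algebra.simps by (intro SUP_eq_const) blast+
qed

lemma (in cartan_datum) atimes_klr_class:
  assumes "p \<in> klr_combs" "q \<in> klr_combs"
  shows "atimes (klr_algebra C P) (klr_class C P p) (klr_class C P q) =
    klr_class C P (klr_mult p q)"
proof -
  have "klr_class C P (klr_mult p' q') = klr_class C P (klr_mult p q)"
    if "p' \<in> klr_class C P p" "q' \<in> klr_class C P q" for p' q'
  proof (rule klr_class_eqI)
    have "klr_mult p' (q' - q) + klr_mult (p' - p) q \<in> klr_ideal C P"
      using that assms
      by (intro klr_ideal_add klr_mult_left_ideal klr_mult_right_ideal) (auto simp: klr_class_def)
    then show "klr_mult p' q' - klr_mult p q \<in> klr_ideal C P"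
      by (simp add: klr_mult_diff_left klr_mult_diff_right)
  qed
  then show ?thesis
    using klr_class_self[OF assms(1), of C P] klr_class_self[OF assms(2), of C P]
    unfolding klr_algebra_def lin_algebra.simps by (intro SUP_eq_const) blast+
qed

text \<open>
  The weight \<open>x\<close> is arbitrary because the scalars of dots and crossings do not depend on it.
\<close>

lemma (in cartan_datum) klr_gimel_klr_class:
  fixes P P' :: "('x, 'i, 'k::field) params"
  assumes gimel: "klr_gimel C P P' r f"
    and p: "p \<in> klr_combs"
  shows "f (klr_class C P p) = klr_class C P'
    (rescale (\<lambda>(is, s). diagram_scale C P P' (DD C P P' r) (gam C P P' r) x s) p)"
proof -
  let ?ds = "diagram_scale C P P' (DD C P P' r) (gam C P P' r) x"
  let ?w = "\<lambda>(is, s). ?ds s"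
  have hom: "f (aplus (klr_algebra C P) a b) = aplus (klr_algebra C P') (f a) (f b)"
    "f (atimes (klr_algebra C P) a b) = atimes (klr_algebra C P') (f a) (f b)"
    "f (ascale (klr_algebra C P) c a) = ascale (klr_algebra C P') c (f a)"
    if "a \<in> acarrier (klr_algebra C P)" "b \<in> acarrier (klr_algebra C P)" for a b c
    using gimel that unfolding klr_gimel_def algebra_iso_def by blast+
  have carrier: "klr_class C P p \<in> acarrier (klr_algebra C P)" if "p \<in> klr_combs" for p
    using that by (simp add: klr_algebra_def)
  have single_combs: "Poly_Mapping.single (is, s) c \<in> klr_combs"
    if "s \<in> klr_diagrams is js" for "is" js s and c :: 'k
    using that by (auto simp: klr_combs_def)
  \<comment> \<open>The top slice is split off as a factor; \<open>f\<close> is multiplicative and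
    prescribed on single slices.\<close>
  have diagram: "f (klr_class C P (Poly_Mapping.single (is, s) 1)) =
      klr_class C P' (Poly_Mapping.single (is, s) (?ds s))"
    if "s \<in> klr_diagrams is js" for "is" js s
    using that
  proof (induction s arbitrary: js)
    case Nil
    then show ?case
      using gimel by (simp add: klr_gimel_def klr_diagram_def)
  next
    case (Cons a s)
    obtain l g u where a: "a = (l, g, u)"
      by (cases a)
    have up_js: "l @ gtrg g @ u = up js" and s: "typed (up is) s (l @ gsrc g @ u)"
      and "upward g" "\<forall>(l, g, u)\<in>set s. upward g"
      using Cons.prems by (auto simp: klr_diagrams_def a)
    \<comment> \<open>The top word of the diagram is upward and contains \<open>l\<close> and
      \<open>u\<close>, so the slice has the form for which \<open>klr_gimel\<close> prescribes a
      value.\<close>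
    obtain ls us where l: "l = up ls" and u: "u = up us"
      using up_js unfolding up_def by (metis map_eq_append_conv)
    define c where "c = gen_scale C P P' (DD C P P' r) (gam C P P' r) (x + wt C u) g"
    obtain ks where ks: "up ks = gsrc g" and
      f_g: "f (klr_diagram C P (ls @ ks @ us) [(l, g, u)]) =
        ascale (klr_algebra C P') c (klr_diagram C P' (ls @ ks @ us) [(l, g, u)])"
    proof (cases g)
      case (Dot i)
      then show ?thesis
        using that[of "[i]"] gimel by (simp add: klr_gimel_def l u c_def)
    next
      case (Cross i j)
      then show ?thesis
        using that[of "[i, j]"] gimel by (simp add: klr_gimel_def l u c_def)
    qed (use \<open>upward g\<close> in simp_all)
    have s_ks: "s \<in> klr_diagrams is (ls @ ks @ us)"
      using s \<open>\<forall>(l, g, u)\<in>set s. upward g\<close> by (simp add: klr_diagrams_def l u ks)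
    have g_ks: "[(l, g, u)] \<in> klr_diagrams (ls @ ks @ us) js"
      using up_js \<open>upward g\<close> by (simp add: klr_diagrams_def l u ks)
    have "klr_class C P (Poly_Mapping.single (is, a # s) 1) =
        atimes (klr_algebra C P) (klr_diagram C P (ls @ ks @ us) [(l, g, u)])
          (klr_class C P (Poly_Mapping.single (is, s) 1))"
      using s_ks g_ks
      by (simp add: klr_diagram_def atimes_klr_class single_combs klr_mult_single a)
    then have "f (klr_class C P (Poly_Mapping.single (is, a # s) 1)) =
        atimes (klr_algebra C P') (f (klr_diagram C P (ls @ ks @ us) [(l, g, u)]))
          (f (klr_class C P (Poly_Mapping.single (is, s) 1)))"
      using s_ks g_ks by (simp add: hom carrier single_combs klr_diagram_def)
    also have "\<dots> = klr_class C P' (Poly_Mapping.single (is, a # s) (c * ?ds s))"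
      using s_ks g_ks unfolding f_g Cons.IH[OF s_ks]
      by (simp add: klr_diagram_def ascale_klr_class atimes_klr_class single_combs klr_mult_single a)
    finally show ?case
      by (simp add: a c_def)
  qed
  have scaled_diagram: "f (klr_class C P (Poly_Mapping.single (is, s) c)) =
      klr_class C P' (Poly_Mapping.single (is, s) (?ds s * c))"
    if s: "s \<in> klr_diagrams is js" for "is" js s c
  proof -
    have "klr_class C P (Poly_Mapping.single (is, s) c) =
        ascale (klr_algebra C P) c (klr_class C P (Poly_Mapping.single (is, s) 1))"
      using s by (simp add: ascale_klr_class single_combs)
    then have "f (klr_class C P (Poly_Mapping.single (is, s) c)) =
        ascale (klr_algebra C P') c (f (klr_class C P (Poly_Mapping.single (is, s) 1)))"
      using hom(3)[OF carrier carrier] single_combs[OF s] by metis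
    then show ?thesis
      using s by (simp add: diagram ascale_klr_class single_combs mult.commute)
  qed
  \<comment> \<open>The zero class is 0 times itself, and its image is a genuine class, so scaling
    by 0 settles it.\<close>
  have zero: "f (klr_class C P 0) = klr_class C P' 0"
  proof -
    have "0 \<in> (klr_combs :: (('i list \<times> 'i diagram) \<Rightarrow>\<^sub>0 'k) set)"
      by (simp add: klr_combs_def)
    moreover obtain q where "q \<in> klr_combs" "f (klr_class C P 0) = klr_class C P' q"
    proof -
      have "f (klr_class C P 0) \<in> acarrier (klr_algebra C P')"
        using gimel carrier[of 0] \<open>0 \<in> klr_combs\<close>
        unfolding klr_gimel_def algebra_iso_def by (blast dest: bij_betw_apply)
      then show ?thesis
        using that by (auto simp: klr_algebra_def)
    qed
    ultimately show ?thesis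
      using hom(3)[OF carrier carrier, of 0 0 0] by (simp add: ascale_klr_class)
  qed
  \<comment> \<open>Induction over subsets of the support of the fixed \<open>p\<close> keeps all
    partial sums in \<open>klr_combs\<close>.\<close>
  have sum: "f (klr_class C P (\<Sum>k\<in>A. Poly_Mapping.single k (Poly_Mapping.lookup p k))) = klr_class C P'
      (rescale ?w (\<Sum>k\<in>A. Poly_Mapping.single k (Poly_Mapping.lookup p k)))"
    if "finite A" "A \<subseteq> Poly_Mapping.keys p" for A
    using that
  proof (induction A)
    case empty
    then show ?case
      by (simp add: zero)
  next
    case (insert k A)
    let ?S = "\<Sum>k\<in>A. Poly_Mapping.single k (Poly_Mapping.lookup p k)"
    let ?c = "Poly_Mapping.lookup p k"
    obtain "is" s js where k: "k = (is, s)" and s: "s \<in> klr_diagrams is js"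
      using insert.prems p by (cases k) (auto simp: klr_combs_def)
    have "Poly_Mapping.keys ?S \<subseteq> (\<Union>k\<in>A. Poly_Mapping.keys (Poly_Mapping.single k (Poly_Mapping.lookup p k)))"
      by (rule keys_sum)
    then have "Poly_Mapping.keys ?S \<subseteq> Poly_Mapping.keys p"
      using insert.prems by (auto split: if_splits)
    then have S: "?S \<in> klr_combs"
      using p by (auto simp: klr_combs_def)
    have "klr_class C P (Poly_Mapping.single k ?c + ?S) = aplus (klr_algebra C P)
        (klr_class C P (Poly_Mapping.single (is, s) ?c)) (klr_class C P ?S)"
      using s S by (simp add: aplus_klr_class single_combs k)
    then have "f (klr_class C P (Poly_Mapping.single k ?c + ?S)) = aplus (klr_algebra C P')
        (f (klr_class C P (Poly_Mapping.single (is, s) ?c))) (f (klr_class C P ?S))"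
      using s S by (simp add: hom(1) carrier single_combs)
    also have "\<dots> = klr_class C P' (rescale ?w (Poly_Mapping.single k ?c + ?S))"
    proof -
      have "rescale ?w ?S \<in> klr_combs"
        using S by (auto simp: klr_combs_def keys_rescale)
      then show ?thesis
        using s insert
        by (simp add: scaled_diagram aplus_klr_class single_combs rescale_add k)
    qed
    finally show ?case
      using insert.hyps by simp
  qed
  show ?thesis
    using sum[OF finite_keys order.refl] unfolding poly_mapping_eq_sum_single[of p, symmetric] .
qed

section \<open>A representation of the KLR algebra\<close>

fun gen_value :: "'i \<Rightarrow> 'i \<Rightarrow> 'k::field \<Rightarrow> 'i gen \<Rightarrow> 'k" where
  "gen_value i j t (Dot k) = (if k = i then 1 else 0)"
| "gen_value i j t (Cross k m) = (if k = i \<and> m = j then 1 else if k = j \<and> m = i then t else 0)"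
| "gen_value i j t _ = 0"

text \<open>Generators send basis vectors to multiples of basis vectors, so a product of scalars
  replaces matrices. The whiskering words may be ignored: starting from ij, a well-typed diagram of
  nonzero value only passes through ij and ji.\<close>

definition diagram_value :: "'i \<Rightarrow> 'i \<Rightarrow> 'k::field \<Rightarrow> 'i diagram \<Rightarrow> 'k" where
  "diagram_value i j t s = (\<Prod>(l, g, u)\<leftarrow>s. gen_value i j t g)"

text \<open>
  The algebra $R_{Q'}$ acts on $\Bbbk^2$ with basis $e_{ij}$, $e_{ji}$ by
  $x_i \mapsto 1$, $x_j \mapsto 0$, $\psi_{ij} e_{ij} = e_{ji}$, $\psi_{ji} e_{ji} = t'_{ij} e_{ij}$;
  all other generators act as zero. \<open>klr_value\<close> is the sum of the coefficients of the
  image of $e_{ij}$.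
\<close>

definition klr_value :: "'i \<Rightarrow> 'i \<Rightarrow> 'k::field \<Rightarrow> (('i list \<times> 'i diagram) \<Rightarrow>\<^sub>0 'k) \<Rightarrow> (unit \<Rightarrow>\<^sub>0 'k)" where
  "klr_value i j t z =
    lin_ext (\<lambda>_. ()) (rescale (\<lambda>(is, s). if is = [i, j] then diagram_value i j t s else 0) z)"

lemma diagram_value_simps [simp]:
  "diagram_value i j t [] = 1"
  "diagram_value i j t ((l, g, u) # s) = gen_value i j t g * diagram_value i j t s"
  "diagram_value i j t (s @ s') = diagram_value i j t s * diagram_value i j t s'"
  by (simp_all add: diagram_value_def)

lemma diagram_value_whisk_diagram [simp]:
  "diagram_value i j t (whisk_diagram l s u) = diagram_value i j t s"
  by (induction s) (auto simp: whisk_diagram_def)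

text \<open>The values lie in \<open>unit \<Rightarrow>\<^sub>0 'k\<close>, a copy of the field, so
  that \<open>pscale\<close> and the span induction apply unchanged.\<close>

lemma klr_value_add: "klr_value i j t (p + q) = klr_value i j t p + klr_value i j t q"
  and klr_value_diff: "klr_value i j t (p - q) = klr_value i j t p - klr_value i j t q"
  and klr_value_pscale: "klr_value i j t (pscale c p) = pscale c (klr_value i j t p)"
  and klr_value_zero [simp]: "klr_value i j t 0 = 0"
  and klr_value_single [simp]: "klr_value i j t (Poly_Mapping.single (is, s) c) =
    Poly_Mapping.single () (if is = [i, j] then diagram_value i j t s * c else 0)"
  by (simp_all add: klr_value_def rescale_add rescale_diff rescale_pscale lin_ext_add lin_ext_diff
      lin_ext_pscale)

text \<open>On the right \<open>[i, j]\<close> is only a formal label: \<open>p\<close> may have any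
  source, since its diagrams keep their values under whiskering.\<close>

lemma klr_value_context_comb:
  "klr_value i j t (at_bottom is (context_comb s2 l p u s1)) =
    pscale (if is = [i, j] then diagram_value i j t s2 * diagram_value i j t s1 else 0)
      (klr_value i j t (at_bottom [i, j] p))"
  by (rule additive_eqI_keys[of "\<lambda>p. klr_value i j t (at_bottom is (context_comb s2 l p u s1))"])
    (auto simp: context_comb_eq_lin_ext lin_ext_add at_bottom_add klr_value_add
      pscale.scale_right_distrib mult_ac)

lemma typed_diagram_value:
  assumes "typed w s w'" "w = [E i, E j]" "diagram_value i j t s \<noteq> 0"
  shows "w' = [E i, E j] \<or> w' = [E j, E i]"
  using assms
proof (induction w s w' rule: typed.induct)
  case (2 w l g u s w')
  then have "l @ gsrc g @ u = [E i, E j] \<or> l @ gsrc g @ u = [E j, E i]"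
    and "gen_value i j t g \<noteq> 0"
    by simp_all
  then show ?case
    using "2.prems"(1)
    by (cases g) (auto simp: append_eq_Cons_conv Cons_eq_append_conv split: if_splits)
qed simp

text \<open>A relation meets a nonzero coefficient only if its source fits into ij or ji, which
  excludes the cubic relation and those with two equal strands. Interchange and dot slides hold
  because scalars commute. For adjacent i, j the right side of the quadratic relation acts by t_ij
  in both orders, as x_i = 1 and x_j = 0.\<close>

lemma klr_value_ideal:
  fixes C :: "('x, 'i, 'q) cartan" and P :: "('x, 'i, 'k::field) params"
  assumes ij: "i \<noteq> j" and scalars: "choice_of_scalars C P" and z: "z \<in> klr_ideal C P"
  shows "klr_value i j (tt P i j) z = 0"
proof -
  have "klr_value i j (tt P i j) z \<in> {0}"
    using z
  proof (rule klr_ideal_map)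
    fix "is" js s2 l u s1 a b and p q :: "('i, 'k) lincomb"
    assume rel: "klr_rel C P a b p q \<or> interchange a b p q"
      and typed: "typed (up is) s1 (l @ a @ u)"
    \<comment> \<open>On e_ji the quadratic relation asks for t_ji where the module yields
      t_ij.\<close>
    have far: "tt P k m = tt P m k" if "k \<noteq> m" "cdot C k m = 0" for k m
      using scalars that by (auto simp: choice_of_scalars_def)
    have "klr_value i j (tt P i j) (at_bottom [i, j] p) =
        klr_value i j (tt P i j) (at_bottom [i, j] q)"
      if "is = [i, j]" "diagram_value i j (tt P i j) s1 \<noteq> 0"
    proof -
      have "l @ a @ u = [E i, E j] \<or> l @ a @ u = [E j, E i]"
        using typed_diagram_value[OF typed _ that(2)] that(1) by simp
      then have letters: "length a \<le> 2" "a = [E k, E m] \<Longrightarrow> k = i \<and> m = j \<or> k = j \<and> m = i" for k m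
        by (auto dest: arg_cong[of _ _ length] simp: append_eq_Cons_conv Cons_eq_append_conv)
      from rel show ?thesis
      proof
        assume "klr_rel C P a b p q"
        then show ?thesis
        proof cases
          case (quad_far k m)
          then show ?thesis
            using letters(2)[of k m] far[of k m] ij by (auto simp: dg_def)
        next
          case (quad_adj k m)
          then show ?thesis
            using letters(2)[of k m] ij by (auto simp: dg_def at_bottom_add klr_value_add)
        qed (use letters ij in \<open>auto simp: dg_def mult.commute\<close>)
      next
        assume "interchange a b p q"
        then show ?thesis
          by cases (simp add: dg_def mult.commute)
      qed
    qed
    then show "klr_value i j (tt P i j)
        (at_bottom is (context_comb s2 l p u s1 - context_comb s2 l q u s1)) \<in> {0}"
      by (cases "diagram_value i j (tt P i j) s1 = 0")
        (auto simp: at_bottom_diff klr_value_diff klr_value_context_comb)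
  qed (simp_all add: klr_value_add klr_value_pscale pscale.subspace_def)
  then show ?thesis
    by simp
qed

lemma (in cartan_datum) klr_gimel_relation:
  fixes P P' :: "('x, 'i, 'k::field) params"
  assumes gimel: "klr_gimel C P P' r f"
    and rel: "klr_rel C P (up is) (up js) p q"
    and combs: "at_bottom is p \<in> klr_combs" "at_bottom is q \<in> klr_combs"
  shows "at_bottom is (rescale (diagram_scale C P P' (DD C P P' r) (gam C P P' r) x) p) -
    at_bottom is (rescale (diagram_scale C P P' (DD C P P' r) (gam C P P' r) x) q)
    \<in> klr_ideal C P'"
proof -
  let ?ds = "diagram_scale C P P' (DD C P P' r) (gam C P P' r) x"
  have empty: "context_comb [] [] p [] [] = p" for p :: "('i, 'k) lincomb"
    by (rule additive_eqI_keys[of "\<lambda>p. context_comb [] [] p [] []"])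
      (simp_all add: context_comb_add, simp add: context_comb_eq_lin_ext whisk_diagram_def)
  have eq: "rescale (\<lambda>(is, s). ?ds s) (at_bottom is p) = at_bottom is (rescale ?ds p)" for p
    unfolding at_bottom_def by (rule rescale_lin_ext) simp
  have "at_bottom is p - at_bottom is q \<in> klr_ideal C P"
    using klr_ideal_base[of C P "up is" "up js" p q "is" "[]" "[]" "[]" "[]" js] rel combs
    by (simp add: empty at_bottom_diff)
  then have "klr_class C P (at_bottom is p) = klr_class C P (at_bottom is q)"
    by (rule klr_class_eqI)
  then have "klr_class C P' (at_bottom is (rescale ?ds p)) =
      klr_class C P' (at_bottom is (rescale ?ds q))"
    using klr_gimel_klr_class[OF gimel combs(1), of x] klr_gimel_klr_class[OF gimel combs(2), of x]
    by (simp add: eq)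
  then show ?thesis
    by (rule klr_class_eqD) (use combs(1) in \<open>auto simp: at_bottom_in_klr_combs keys_rescale\<close>)
qed

lemma DD_nonzero:
  assumes "\<And>i j. tt P i j \<noteq> 0" "\<And>i j. tt P' i j \<noteq> 0"
  shows "DD C P P' r i \<noteq> 0"
  using assms by (auto simp: DD_def Let_def prod_list_zero_iff vv_def)

lemma gam_nonzero:
  assumes "\<And>i j. tt P i j \<noteq> 0" "\<And>i j. tt P' i j \<noteq> 0"
  shows "gam C P P' r i j \<noteq> 0"
  using assms DD_nonzero[OF assms, of C r] by (simp add: gam_def)

lemma klr_gimel_rescaling:
  fixes P P' :: "('x::ab_group_add, 'i, 'k::field) params"
  assumes C: "cartan_datum C"
    and params: "choice_of_scalars C P" "bubble_parameters P" "compatible_params C P"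
      "choice_of_scalars C P'" "bubble_parameters P'" "compatible_params C P'"
    and gimel: "klr_gimel C P P' r f"
  shows "rescaling C P P' (DD C P P' r) (gam C P P' r)"
proof -
  interpret cartan_datum C
    by (rule C)
  let ?D = "DD C P P' r" and ?G = "gam C P P' r"
  have nonzero: "tt P i j \<noteq> 0" "tt P' i j \<noteq> 0" for i j
    by (rule params_tt_nonzero[OF params(1,2)], rule params_tt_nonzero[OF params(4,5)])
  let ?cc = "\<lambda>i j. dg [([], Cross j i, []), ([], Cross i j, [])] :: ('i, 'k) lincomb"
  have val_eq: "klr_value i j (tt P' i j) (at_bottom [i, j] (rescale (diagram_scale C P P' ?D ?G 0) (?cc i j))) =
      klr_value i j (tt P' i j) (at_bottom [i, j] (rescale (diagram_scale C P P' ?D ?G 0) q))"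
    if "i \<noteq> j" "klr_rel C P [E i, E j] [E i, E j] (?cc i j) q" "at_bottom [i, j] q \<in> klr_combs" for i j q
  proof -
    have "at_bottom [i, j] (?cc i j) \<in> klr_combs"
      by (auto simp: klr_combs_def dg_def klr_diagrams_def intro!: exI[of _ "[i, j]"])
    with that(2,3) have "at_bottom [i, j] (rescale (diagram_scale C P P' ?D ?G 0) (?cc i j)) -
        at_bottom [i, j] (rescale (diagram_scale C P P' ?D ?G 0) q) \<in> klr_ideal C P'"
      by (intro klr_gimel_relation[OF gimel, of "[i, j]" "[i, j]"]) simp_all
    from klr_value_ideal[OF that(1) params(4) this] show ?thesis
      by (simp only: klr_value_diff eq_iff_diff_eq_0[symmetric])
  qed
  show ?thesis
  proof
    fix i j
    show "?G i j * ?G j i * tt P' i j = tt P i j" if "i \<noteq> j" "cdot C i j = 0"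
    proof -
      have "at_bottom [i, j] (pscale (tt P i j) (dg []) :: ('i, 'k) lincomb) \<in> klr_combs"
        by (auto simp: klr_combs_def dg_def klr_diagrams_def intro!: exI[of _ "[i, j]"])
      \<comment> \<open>On e_ij the two crossings contribute \<gamma>_ji t'_ij and \<gamma>_ij, the
        other side t_ij.\<close>
      from val_eq[OF that(1) klr_rel.quad_far[OF that] this,
          THEN arg_cong[of _ _ "\<lambda>p. Poly_Mapping.lookup p ()"]] show ?thesis
        using that(1) by (simp add: dg_def lookup_add mult_ac)
    qed
    show "?G i j * ?G j i * tt P' i j = ?D i * tt P i j" if "i \<noteq> j" "cdot C i j = -1"
    proof -
      have "at_bottom [i, j] (pscale (tt P i j) (dg [([], Dot i, [E j])]) +
          pscale (tt P j i) (dg [([E i], Dot j, [])]) :: ('i, 'k) lincomb) \<in> klr_combs"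
        using nonzero
        by (auto simp: at_bottom_in_klr_combs dg_def klr_diagrams_def dest!: subsetD[OF keys_add]
            intro!: exI[of _ "[i, j]"])
      \<comment> \<open>The dot on the j-strand acts by 0 and the one on the i-strand by 1, which
        isolates D_i t_ij.\<close>
      from val_eq[OF that(1) klr_rel.quad_adj[OF that] this,
          THEN arg_cong[of _ _ "\<lambda>p. Poly_Mapping.lookup p ()"]] show ?thesis
        using that(1)
        by (simp add: dg_def rescale_add at_bottom_add klr_value_add lookup_add mult_ac)
    qed
    show "?D i \<noteq> 0" "?G i j \<noteq> 0"
      using DD_nonzero[OF nonzero] gam_nonzero[OF nonzero] by blast+
    show "?G i i = inverse (?D i)"
      by (simp add: gam_def)
  qed (fact params)+
qed

section \<open>Compatibility with the KLR algebras\<close>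

text \<open>An expression of \<open>z\<close> through ideal generators may involve other bottoms,
  tops and degrees that cancel. Projecting to the prescribed ones fixes \<open>z\<close> and maps
  each generator to itself or to 0, since generators are homogeneous.\<close>

lemma (in cartan_datum) klr_ideal_hom_null:
  fixes P :: "('x, 'i, 'k::field) params"
  assumes "at_bottom is z \<in> klr_ideal C P" and z: "z \<in> hom_combs C x (up is) (up js) d"
  shows "z \<in> hom_null C P x (up is) (up js) d"
proof -
  define good where "good s = (if typed (up is) s (up js) \<and> ddeg C x s = d then 1 else 0 :: 'k)" for s
  define proj where "proj p = rescale good (Poly_Mapping.map_key (Pair is) p)" for p
  have inj: "inj (Pair is)"
    by (simp add: inj_def)
  have proj_at_bottom: "proj (at_bottom is' p) = (if is' = is then rescale good p else 0)" for is' p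
    unfolding proj_def
    by (rule poly_mapping_eqI) (simp add: map_key.rep_eq[OF inj] lookup_at_bottom)
  have rescale_good: "rescale good p = p" if "p \<in> hom_combs C x (up is) (up js) d" for p
    using that by (intro poly_mapping_eqI) (force simp: good_def hom_combs_def in_keys_iff)
  have "proj (at_bottom is z) \<in> hom_null C P x (up is) (up js) d"
    using assms(1)
  proof (rule klr_ideal_map)
    show "proj (p + q) = proj p + proj q" for p q
      by (simp add: proj_def map_key_plus[OF inj] rescale_add)
    show "proj (pscale c p) = pscale c (proj p)" for c p
      unfolding proj_def by (rule poly_mapping_eqI) (simp add: map_key.rep_eq[OF inj])
    show "module.subspace pscale (hom_null C P x (up is) (up js) d)"
      unfolding hom_null_def by (rule pscale.subspace_span)
  next
    fix is' js' s2 l u s1 a b and p q :: "('i, 'k) lincomb"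
    assume gen: "klr_rel C P a b p q \<or> interchange a b p q"
      "typed (up is') s1 (l @ a @ u)" "typed (l @ b @ u) s2 (up js')"
    obtain e where e: "context_comb s2 l p u s1 \<in> hom_combs C x (up is') (up js') e"
      "context_comb s2 l q u s1 \<in> hom_combs C x (up is') (up js') e"
      using klr_relation_context[OF gen] .
    show "proj (at_bottom is' (context_comb s2 l p u s1 - context_comb s2 l q u s1))
        \<in> hom_null C P x (up is) (up js) d"
    proof (cases "is' = is \<and> js' = js \<and> e = d")
      case True
      then have "context_comb s2 l p u s1 - context_comb s2 l q u s1
          \<in> hom_null C P x (up is) (up js) d"
        unfolding hom_null_def using gen e
        by (intro pscale.span_base) (blast intro: u_rel.klr u_rel.interchange)
      then show ?thesis
        using True e by (simp add: proj_at_bottom rescale_good hom_combs_diff)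
    next
      case False
      \<comment> \<open>With equal bottoms the mismatch is in the top or the degree, and a diagram
        determines both, so no term of the generator survives.\<close>
      have zero: "rescale good r = 0" if "r \<in> hom_combs C x (up is') (up js') e" "is' = is" for r
      proof (rule poly_mapping_eqI)
        fix s
        show "Poly_Mapping.lookup (rescale good r) s = Poly_Mapping.lookup 0 s"
          using that False typed_unique[of "up is" s "up js" "up js'"]
          by (cases "s \<in> Poly_Mapping.keys r") (auto simp: hom_combs_def good_def in_keys_iff)
      qed
      show ?thesis
        using zero[OF e(1)] zero[OF e(2)] by (simp add: proj_at_bottom rescale_diff hom_null_zero)
    qed
  qed
  then show ?thesis
    by (simp add: proj_at_bottom rescale_good z)
qed

theorem theorem3p5:
  fixes C :: "('x::ab_group_add, 'i, 'q::field_char_0) cartan"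
    and P P' :: "('x, 'i, 'k::field) params"
    and r :: 'i
    and gimel0 :: "(('i list \<times> 'i diagram) \<Rightarrow>\<^sub>0 'k) set \<Rightarrow> (('i list \<times> 'i diagram) \<Rightarrow>\<^sub>0 'k) set"
  assumes "cartan_datum C"
    and "graph_is_tree C"
    and "choice_of_scalars C P" and "bubble_parameters P" and "compatible_params C P"
    and "choice_of_scalars C P'" and "bubble_parameters P'" and "compatible_params C P'"
    and "klr_gimel C P P' r gimel0"
  shows "\<exists>gimel.
    two_cat_iso (U_cat C P) (U_cat C P') id id gimel \<and>
    extends_klr C P P' gimel0 gimel \<and>
    (\<forall>i x. gimel (gen_cell C P x (Dot i))
       = scale2 (U_cat C P') (DD C P P' r i) (gen_cell C P' x (Dot i))) \<and>
    (\<forall>i j x. gimel (gen_cell C P x (Cross i j))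
       = scale2 (U_cat C P') (gam C P P' r i j) (gen_cell C P' x (Cross i j))) \<and>
    (\<forall>i x. gimel (gen_cell C P x (Eps i))
       = scale2 (U_cat C P')
           (DD C P P' r i powi (- coroot C i x + 1) * (cpl P i x / cpl P' i x))
           (gen_cell C P' x (Eps i))) \<and>
    (\<forall>i x. gimel (gen_cell C P x (Eta i))
       = scale2 (U_cat C P')
           (DD C P P' r i powi (coroot C i x + 1)
             * (cpl P' i (x + rt C i) / cpl P i (x + rt C i)))
           (gen_cell C P' x (Eta i))) \<and>
    (\<forall>i x. gimel (gen_cell C P x (Eps' i)) = gen_cell C P' x (Eps' i)) \<and>
    (\<forall>i x. gimel (gen_cell C P x (Eta' i)) = gen_cell C P' x (Eta' i))"
proof -
  interpret rescaling C P P' "DD C P P' r" "gam C P P' r"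
    by (rule klr_gimel_rescaling) (use assms in blast)+
  have scale_1: "scale2 (U_cat C P') 1 (gen_cell C P' x g) = gen_cell C P' x g" for x g
    unfolding scale2_gen_cell by (simp add: gen_cell_def)
  have "extends_klr C P P' gimel0 rescale_cell"
    unfolding extends_klr_def
  proof (intro allI impI)
    fix x "is" js d and p q :: "('i, 'k) lincomb"
    assume p: "p \<in> hom_combs C x (up is) (up js) d" "Poly_Mapping.keys p \<subseteq> klr_diagrams is js"
      and q: "q \<in> hom_combs C x (up is) (up js) d" "Poly_Mapping.keys q \<subseteq> klr_diagrams is js"
      and eq: "gimel0 (klr_class C P (at_bottom is p)) = klr_class C P' (at_bottom is q)"
    have p_combs: "at_bottom is p \<in> klr_combs"
      using p(2) by (auto simp: at_bottom_in_klr_combs)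
    have "rescale (\<lambda>(is, s). ds x s) (at_bottom is p) = at_bottom is (rescale (ds x) p)"
      unfolding at_bottom_def by (rule rescale_lin_ext) simp
    \<comment> \<open>Both sides are the value of \<open>gimel0\<close> on the class of
      \<open>p\<close>: one computed by multiplicativity from the generators, the other by the
      choice of \<open>q\<close>.\<close>
    then have "klr_class C P' (at_bottom is (rescale (ds x) p)) = klr_class C P' (at_bottom is q)"
      using klr_gimel_klr_class[OF assms(9) p_combs, of x] eq by simp
    moreover have "at_bottom is (rescale (ds x) p) \<in> klr_combs"
      using p(2) by (auto simp: at_bottom_in_klr_combs keys_rescale)
    ultimately have "at_bottom is (rescale (ds x) p - q) \<in> klr_ideal C P'"
      unfolding at_bottom_diff by (rule klr_class_eqD)
    then have "rescale (ds x) p - q \<in> hom_null C P' x (up is) (up js) d"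
      by (rule klr_ideal_hom_null) (simp add: hom_combs_diff p q)
    then show "rescale_cell (cell C P x (up is) (up js) d p) = cell C P' x (up is) (up js) d q"
      unfolding rescale_cell_cell by (rule cell_eqI)
  qed
  \<comment> \<open>The formulas for \<open>Eta\<close> and \<open>Eps\<close>, kept opaque since
    the relations were checked, are unfolded again to match the statement.\<close>
  then show ?thesis
    using two_cat_iso_rescale_cell
    by (intro exI[of _ rescale_cell] conjI) (simp_all add: rescale_cell_gen_cell scale_1 gen_scale.simps(3,4))
qed

end
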